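(* Let $(\mathfrak g,\cdot_{\mathfrak g})$ and $(\mathfrak g^*,\cdot_{\mathfrak g^*})$ be two mock-pre-Lie algebras, and let $\alpha:\mathfrak g\to\mathfrak g\otimes\mathfrak g$ and $\beta:\mathfrak g^*\to\mathfrak g^*\otimes\mathfrak g^*$ be the dual maps of $\cdot_{\mathfrak g^*}$ and $\cdot_{\mathfrak g}$, i.e. $\langle\alpha(x),\xi\otimes\eta\rangle=\langle x,\xi\cdot_{\mathfrak g^*}\eta\rangle$ and $\langle\beta(\xi),x\otimes y\rangle=\langle\xi,x\cdot_{\mathfrak g}y\rangle$. Then the following conditions are equivalent: (i) $(\mathfrak g,\mathfrak g^*,\alpha,\beta)$ is a mock-pre-Lie bialgebra. (ii) $(\mathfrak g,\mathfrak g^*;(-L^*-R^*,R^* ),(-\mathcal L^*-\mathcal R^*,\mathcal R^* ))$ is a matched pair of mock-pre-Lie algebras. (iii) $(\mathcal G=\mathfrak g\oplus\mathfrak g^*,\mathfrak g,\mathfrak g^* )$ is a Manin triple of mock-pre-Lie algebras, where the invariant skew-symmetric bilinear form on $\mathfrak g\oplus\mathfrak g^*$ is $\omega(x+\xi,y+\eta)=\langle\xi,y\rangle-\langle\eta,x\rangle$ (that is, there is a mock-pre-Lie product on $\mathfrak g\oplus\mathfrak g^*$, restricting to $\cdot_{\mathfrak g}$ on $\mathfrak g$ and to $\cdot_{\mathfrak g^*}$ on $\mathfrak g^*$, for which $(\mathfrak g\oplus\mathfrak g^*,\omega)$ is a quadratic mock-pre-Lie algebra). (iv) $(\mathfrak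 g_c,\mathfrak g_c^*;-L^*,-\mathcal L^* )$ is a matched pair of mock-Lie algebras, where $\mathfrak g_c,\mathfrak g^*_c$ are the sub-adjacent mock-Lie algebras. (v) $(\mathfrak g_c\oplus\mathfrak g_c^*,\{\cdot,\cdot\},\omega)$ is a phase space of the sub-adjacent mock-Lie algebra $(\mathfrak g_c,\{\cdot,\cdot\}_{\mathfrak g})$, where $\{x+\xi,y+\eta\}=\{x,y\}_{\mathfrak g}-\mathcal L^*_\xi y-\mathcal L^*_\eta x+\{\xi,\eta\}_{\mathfrak g^*}-L^*_x\eta-L^*_y\xi$ for $x,y\in\mathfrak g$, $\xi,\eta\in\mathfrak g^*$.
   Context: All vector spaces are finite-dimensional over an algebraically closed field $\mathbb K$ of characteristic $0$; $\langle\cdot,\cdot\rangle$ is the natural pairing with the dual space. A mock-Lie algebra is a vector space with a symmetric bilinear bracket satisfying $\{x,\{y,z\}\}+\{y,\{z,x\}\}+\{z,\{x,y\}\}=0$. A representation of it on $V$ is a linear map $\rho:\mathfrak g\to\mathfrak{gl}(V)$ with $\rho(\{x,y\})=-\rho(x)\rho(y)-\rho(y)\rho(x)$. A mock-pre-Lie algebra is a vector space with a bilinear product satisfying $(x\cdot y)\cdot z+x\cdot(y\cdot z)=-(y\cdot x)\cdot z-y\cdot(x\cdot z)$; its sub-adjacent mock-Lie algebra $\mathfrak g_c$ has bracket $x\cdot y+y\cdot x$. We write $\{x,y\}_{\mathfrak g}=x\cdot_{\mathfrak g}y+y\cdot_{\mathfrak g}x$ and $\{\xi,\eta\}_{\mathfrak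 g^*}=\xi\cdot_{\mathfrak g^*}\eta+\eta\cdot_{\mathfrak g^*}\xi$. A representation of a mock-pre-Lie algebra $(\mathfrak g,\cdot)$ on $V$ is a pair $(\rho,\mu)$ of linear maps $\mathfrak g\to\mathfrak{gl}(V)$ such that $\rho$ is a representation of $\mathfrak g_c$ and $\rho(x)\mu(y)+\mu(y)\rho(x)=-\mu(x\cdot y)-\mu(y)\mu(x)$. Notation: $L_xy=x\cdot_{\mathfrak g}y$, $R_xy=y\cdot_{\mathfrak g}x$, $\mathcal L_\xi\eta=\xi\cdot_{\mathfrak g^*}\eta$, $\mathcal R_\xi\eta=\eta\cdot_{\mathfrak g^*}\xi$. Dual maps carry a minus sign: $\langle L_x^*\xi,y\rangle=-\langle\xi,L_xy\rangle$, $\langle R_x^*\xi,y\rangle=-\langle\xi,R_xy\rangle$, $\langle\mathcal L_\xi^*x,\eta\rangle=-\langle x,\mathcal L_\xi\eta\rangle$, $\langle\mathcal R_\xi^*x,\eta\rangle=-\langle x,\mathcal R_\xi\eta\rangle$. Mock-pre-Lie bialgebra: $(\mathfrak g,\mathfrak g^*,\alpha,\beta)$, where the dual maps $\alpha^*=\cdot_{\mathfrak g^*}$ and $\beta^*=\cdot_{\mathfrak g}$ are mock-pre-Lie products on $\mathfrak g^*$ and $\mathfrak g$ and, for all $x,y\in\mathfrak g$, $\xi,\eta\in\mathfrak g^*$, $$\alpha\{x,y\}_{\mathfrak g}=-(\mathrm{Id}\otimes(R_y+L_y)+L_y\otimes\mathrm{Id})\alpha(x)-(\mathrm{Id}\otimes(L_x+R_x)+L_x\otimes\mathrm{Id})\alpha(y),$$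 $$\beta\{\xi,\eta\}_{\mathfrak g^*}=-(\mathrm{Id}\otimes(\mathcal R_\eta+\mathcal L_\eta)+\mathcal L_\eta\otimes\mathrm{Id})\beta(\xi)-(\mathrm{Id}\otimes(\mathcal L_\xi+\mathcal R_\xi)+\mathcal L_\xi\otimes\mathrm{Id})\beta(\eta).$$ Matched pair of mock-pre-Lie algebras $(\mathfrak g,\mathfrak h;(\rho_{\mathfrak g},\mu_{\mathfrak g}),(\rho_{\mathfrak h},\mu_{\mathfrak h}))$: mock-pre-Lie algebras $\mathfrak g,\mathfrak h$, a representation $(\rho_{\mathfrak g},\mu_{\mathfrak g})$ of $\mathfrak g$ on $\mathfrak h$ and a representation $(\rho_{\mathfrak h},\mu_{\mathfrak h})$ of $\mathfrak h$ on $\mathfrak g$ such that for all $x,y\in\mathfrak g$, $u,v\in\mathfrak h$: $$0=\mu_{\mathfrak h}(u)\{x,y\}_{\mathfrak g}+\mu_{\mathfrak h}(\rho_{\mathfrak g}(y)u)x+\mu_{\mathfrak h}(\rho_{\mathfrak g}(x)u)y+x\cdot_{\mathfrak g}(\mu_{\mathfrak h}(u)y)+y\cdot_{\mathfrak g}(\mu_{\mathfrak h}(u)x),$$ $$0=\mu_{\mathfrak g}(x)\{u,v\}_{\mathfrak h}+\mu_{\mathfrak g}(\rho_{\mathfrak h}(v)x)u+\mu_{\mathfrak g}(\rho_{\mathfrak h}(u)x)v+u\cdot_{\mathfrak h}(\mu_{\mathfrak g}(x)v)+v\cdot_{\mathfrak h}(\mu_{\mathfrak g}(x)u),$$ $$-\rho_{\mathfrak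 h}(u)(x\cdot_{\mathfrak g}y)=\rho_{\mathfrak h}(\rho_{\mathfrak g}(x)u+\mu_{\mathfrak g}(x)u)y+(\rho_{\mathfrak h}(u)x+\mu_{\mathfrak h}(u)x)\cdot_{\mathfrak g}y+\mu_{\mathfrak h}(\mu_{\mathfrak g}(y)u)x+x\cdot_{\mathfrak g}(\rho_{\mathfrak h}(u)y),$$ $$-\rho_{\mathfrak g}(x)(u\cdot_{\mathfrak h}v)=\rho_{\mathfrak g}(\rho_{\mathfrak h}(u)x+\mu_{\mathfrak h}(u)x)v+(\rho_{\mathfrak g}(x)u+\mu_{\mathfrak g}(x)u)\cdot_{\mathfrak h}v+\mu_{\mathfrak g}(\mu_{\mathfrak h}(v)x)u+u\cdot_{\mathfrak h}(\rho_{\mathfrak g}(x)v).$$ Matched pair of mock-Lie algebras $(\mathfrak g,\mathfrak h;\rho,\mu)$: mock-Lie algebras $\mathfrak g,\mathfrak h$, a representation $\rho$ of $\mathfrak g$ on $\mathfrak h$ and a representation $\mu$ of $\mathfrak h$ on $\mathfrak g$ such that $$\rho(x)\{u,v\}_{\mathfrak h}+\{\rho(x)u,v\}_{\mathfrak h}+\{u,\rho(x)v\}_{\mathfrak h}+\rho(\mu(u)x)v+\rho(\mu(v)x)u=0,$$ $$\mu(u)\{x,y\}_{\mathfrak g}+\{\mu(u)x,y\}_{\mathfrak g}+\{x,\mu(u)y\}_{\mathfrak g}+\mu(\rho(x)u)y+\mu(\rho(y)u)x=0.$$ Quadratic mock-pre-Lie algebra: a mock-pre-Lie algebra with a nondegenerate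 skew-symmetric bilinear form $\omega$ satisfying the invariance $\omega(x\cdot y,z)=\omega(y,x\cdot z+z\cdot x)$. Manin triple $(\mathcal G,\mathfrak g,\mathfrak g')$: $\mathcal G$ is a quadratic mock-pre-Lie algebra which is the vector space direct sum of two isotropic mock-pre-Lie subalgebras $\mathfrak g,\mathfrak g'$. Symplectic mock-Lie algebra: a mock-Lie algebra with a nondegenerate skew-symmetric bilinear form $\omega$ satisfying $\omega(\{x,y\},z)+\omega(\{y,z\},x)+\omega(\{z,x\},y)=0$. Phase space of a mock-Lie algebra $\mathfrak g$: a symplectic mock-Lie algebra $(\mathfrak g\oplus\mathfrak g^*,\{\cdot,\cdot\},\omega)$ with $\omega(x+\xi,y+\eta)=\langle\xi,y\rangle-\langle\eta,x\rangle$ such that $\mathfrak g$ (with its given bracket) and $\mathfrak g^*$ are mock-Lie subalgebras. *)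

theory Defs
  imports "HOL-Analysis.Product_Vector" "HOL-Library.Function_Algebras"
    "HOL-Computational_Algebra.Polynomial"
begin

section \<open>Vector spaces, linear maps, duals\<close>

text \<open>
  A vector space is a subset \<open>V\<close> of an ambient vector space with scalar multiplication \<open>s\<close>.
  This is needed because the dual of a space over a general field \<open>'k\<close> cannot be a type of its own;
  it is a set of functions \<open>'v \<Rightarrow> 'k\<close>. All operations below matter only on their carriers.
\<close>

definition fd_space :: "('k::field \<Rightarrow> 'v::ab_group_add \<Rightarrow> 'v) \<Rightarrow> 'v set \<Rightarrow> bool" where
  "fd_space s V \<longleftrightarrow> vector_space s \<and> (\<exists>B. finite B \<and> V = module.span s B)"

definition linear_on :: "('k::field \<Rightarrow> 'v::ab_group_add \<Rightarrow> 'v) \<Rightarrow> 'v set \<Rightarrow>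
    ('k \<Rightarrow> 'w::ab_group_add \<Rightarrow> 'w) \<Rightarrow> 'w set \<Rightarrow> ('v \<Rightarrow> 'w) \<Rightarrow> bool" where
  "linear_on s V t W f \<longleftrightarrow>
     (\<forall>x\<in>V. f x \<in> W) \<and>
     (\<forall>x\<in>V. \<forall>y\<in>V. f (x + y) = f x + f y) \<and>
     (\<forall>c. \<forall>x\<in>V. f (s c x) = t c (f x))"

definition bilinear_on :: "('k::field \<Rightarrow> 'u::ab_group_add \<Rightarrow> 'u) \<Rightarrow> 'u set \<Rightarrow>
    ('k \<Rightarrow> 'v::ab_group_add \<Rightarrow> 'v) \<Rightarrow> 'v set \<Rightarrow>
    ('k \<Rightarrow> 'w::ab_group_add \<Rightarrow> 'w) \<Rightarrow> 'w set \<Rightarrow> ('u \<Rightarrow> 'v \<Rightarrow> 'w) \<Rightarrow> bool" where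
  "bilinear_on r U s V t W f \<longleftrightarrow>
     (\<forall>x\<in>U. linear_on s V t W (f x)) \<and> (\<forall>y\<in>V. linear_on r U t W (\<lambda>x. f x y))"

definition fun_scale :: "'k::field \<Rightarrow> ('v \<Rightarrow> 'k) \<Rightarrow> 'v \<Rightarrow> 'k" where
  "fun_scale c f = (\<lambda>v. c * f v)"

text \<open>Functionals are made to vanish off \<open>V\<close>, so that each has a single representative.\<close>

definition dual_space :: "('k::field \<Rightarrow> 'v::ab_group_add \<Rightarrow> 'v) \<Rightarrow> 'v set \<Rightarrow> ('v \<Rightarrow> 'k) set" where
  "dual_space s V = {\<phi>. linear_on s V (*) UNIV \<phi> \<and> (\<forall>v. v \<notin> V \<longrightarrow> \<phi> v = 0)}"

text \<open>The canonical embedding of \<open>V\<close> into its bidual.\<close>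

definition eval_at :: "('k::field \<Rightarrow> 'v::ab_group_add \<Rightarrow> 'v) \<Rightarrow> 'v set \<Rightarrow> 'v \<Rightarrow> ('v \<Rightarrow> 'k) \<Rightarrow> 'k" where
  "eval_at s V v = (\<lambda>\<phi>. if \<phi> \<in> dual_space s V then \<phi> v else 0)"

definition transpose_on :: "'v set \<Rightarrow> ('v \<Rightarrow> 'v) \<Rightarrow> ('v \<Rightarrow> 'k::field) \<Rightarrow> 'v \<Rightarrow> 'k" where
  "transpose_on V A \<phi> = (\<lambda>v. if v \<in> V then \<phi> (A v) else 0)"

text \<open>
  Duals of endomorphisms carry a minus sign. The dual of an endomorphism of \<open>V\<close> acts on the dual
  space; the dual of an endomorphism of the dual space acts on \<open>V\<close> itself (identified with its
  bidual), where it is determined by the pairing.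
\<close>

definition neg_dual :: "'v set \<Rightarrow> ('v \<Rightarrow> 'v) \<Rightarrow> ('v \<Rightarrow> 'k::field) \<Rightarrow> 'v \<Rightarrow> 'k" where
  "neg_dual V A \<phi> = (\<lambda>v. if v \<in> V then - \<phi> (A v) else 0)"

definition neg_predual :: "('k::field \<Rightarrow> 'v::ab_group_add \<Rightarrow> 'v) \<Rightarrow> 'v set \<Rightarrow>
    (('v \<Rightarrow> 'k) \<Rightarrow> ('v \<Rightarrow> 'k)) \<Rightarrow> 'v \<Rightarrow> 'v" where
  "neg_predual s V F x = (THE y. y \<in> V \<and> (\<forall>\<eta>\<in>dual_space s V. \<eta> y = - F \<eta> x))"

lemma fd_space_dual_basis:
  assumes "fd_space s V"
  obtains B e where "finite B" "B \<subseteq> V" "\<And>b. b \<in> B \<Longrightarrow> e b \<in> dual_space s V"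
    "\<And>b c. b \<in> B \<Longrightarrow> c \<in> B \<Longrightarrow> e b c = (if b = c then 1 else 0)"
    "\<And>v. v \<in> V \<Longrightarrow> v = (\<Sum>b\<in>B. s (e b v) b)"
proof -
  interpret vector_space s using assms by (simp add: fd_space_def)
  obtain B0 where B0: "finite B0" "V = span B0" using assms by (auto simp: fd_space_def)
  obtain B where B: "B \<subseteq> B0" "independent B" "B0 \<subseteq> span B"
    by (rule maximal_independent_subset[of B0])
  have fin: "finite B" using B(1) B0(1) finite_subset by blast
  have V: "V = span B"
    unfolding B0(2) using B(1,3) by (intro subset_antisym span_minimal subspace_span span_mono)
  define e where "e b v = (if v \<in> V then representation B v b else 0)" for b v
  have e: "e b v = representation B v b" if "v \<in> V" for b v
    using that by (simp add: e_def)
  have V_add: "x + y \<in> V" and V_scale: "s c x \<in> V" if "x \<in> V" "y \<in> V" for x y c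
    using that by (simp_all add: V span_add span_scale)
  show thesis
  proof (rule that)
    show "finite B" by (rule fin)
    show BV: "B \<subseteq> V" unfolding V by (rule span_superset)
    show "e b \<in> dual_space s V" for b
      unfolding dual_space_def linear_on_def
    proof (intro CollectI conjI ballI allI impI)
      show "e b (x + y) = e b x + e b y" if "x \<in> V" "y \<in> V" for x y
        using representation_add[OF B(2)] that by (simp add: e V_add) (simp add: V)
      show "e b (s c x) = c * e b x" if "x \<in> V" for c x
        using representation_scale[OF B(2)] that by (simp add: e V_scale) (simp add: V)
    qed (simp_all add: e_def)
    show "e b c = (if b = c then 1 else 0)" if "b \<in> B" "c \<in> B" for b c
      using that BV by (simp add: e representation_basis[OF B(2)] subset_iff)
    show "v = (\<Sum>b\<in>B. s (e b v) b)" if "v \<in> V" for v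
      using sum_representation_eq[OF B(2) _ fin subset_refl, of v] that by (simp add: e) (simp add: V)
  qed
qed

lemma linear_on_sum:
  assumes "linear_on s V t W f" "vector_space s" "module.subspace s V" "vector_space t"
    "finite B" "\<And>b. b \<in> B \<Longrightarrow> g b \<in> V"
  shows "f (\<Sum>b\<in>B. s (c b) (g b)) = (\<Sum>b\<in>B. t (c b) (f (g b)))"
proof -
  interpret S: vector_space s by fact
  interpret T: vector_space t by fact
  note sub = assms(3)
  have f0: "f 0 = 0"
  proof -
    have "f (s 0 0) = t 0 (f 0)" using assms(1) S.subspace_0[OF sub] unfolding linear_on_def by blast
    then show ?thesis by simp
  qed
  show ?thesis using assms(5,6)
  proof (induction B rule: finite_induct)
    case empty
    then show ?case by (simp add: f0)
  next
    case (insert b B)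
    have "s (c b) (g b) \<in> V" "(\<Sum>b\<in>B. s (c b) (g b)) \<in> V"
      using insert.prems by (auto intro!: S.subspace_sum[OF sub] S.subspace_scale[OF sub])
    then show ?case using insert assms(1) by (simp add: linear_on_def)
  qed
qed

lemma fd_space_subspace: "fd_space s V \<Longrightarrow> module.subspace s V"
  unfolding fd_space_def module_iff_vector_space[symmetric] by (auto simp: module.subspace_span)

lemma vector_space_mult: "vector_space ((*) :: 'k::field \<Rightarrow> 'k \<Rightarrow> 'k)"
  by unfold_locales (auto simp: algebra_simps)

lemma vector_space_fun_scale: "vector_space (fun_scale :: 'k::field \<Rightarrow> ('v \<Rightarrow> 'k) \<Rightarrow> _)"
  by unfold_locales (auto simp: fun_scale_def fun_eq_iff algebra_simps)

lemma dual_space_subspace: "module.subspace fun_scale (dual_space s V)"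
proof -
  interpret vector_space "fun_scale :: 'a \<Rightarrow> ('b \<Rightarrow> 'a) \<Rightarrow> _" by (rule vector_space_fun_scale)
  show ?thesis
    by (auto simp: subspace_def dual_space_def linear_on_def fun_scale_def algebra_simps)
qed

lemma functional_expand:
  assumes "fd_space s V" "\<phi> \<in> dual_space s V" "finite B" "B \<subseteq> V" "v = (\<Sum>b\<in>B. s (c b) b)"
  shows "\<phi> v = (\<Sum>b\<in>B. c b * \<phi> b)"
  using linear_on_sum[of s V "(*)" UNIV \<phi> B "\<lambda>b. b" c] assms fd_space_subspace vector_space_mult
  by (auto simp: dual_space_def fd_space_def)

lemma fd_space_dual:
  assumes "fd_space s V"
  shows "fd_space fun_scale (dual_space s V)"
proof -
  interpret F: vector_space "fun_scale :: 'a \<Rightarrow> ('b \<Rightarrow> 'a) \<Rightarrow> _" by (rule vector_space_fun_scale)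
  obtain B e where B: "finite B" "B \<subseteq> V" "\<And>b. b \<in> B \<Longrightarrow> e b \<in> dual_space s V"
    "\<And>v. v \<in> V \<Longrightarrow> v = (\<Sum>b\<in>B. s (e b v) b)"
    by (rule fd_space_dual_basis[OF assms]) blast
  have expand: "\<phi> = (\<Sum>b\<in>B. fun_scale (\<phi> b) (e b))" if "\<phi> \<in> dual_space s V" for \<phi>
  proof
    fix v
    have sum_ev: "(\<Sum>b\<in>B. fun_scale (\<phi> b) (e b)) v = (\<Sum>b\<in>B. \<phi> b * e b v)"
      using B(1) by (induction B rule: finite_induct) (auto simp: fun_scale_def)
    show "\<phi> v = (\<Sum>b\<in>B. fun_scale (\<phi> b) (e b)) v"
    proof (cases "v \<in> V")
      case True
      then show ?thesis unfolding sum_ev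
        using functional_expand[OF assms that B(1,2) B(4)] by (simp add: mult.commute)
    next
      case False
      then show ?thesis unfolding sum_ev
        using that B(3) by (simp add: dual_space_def)
    qed
  qed
  have "dual_space s V = F.span (e ` B)"
  proof
    show "F.span (e ` B) \<subseteq> dual_space s V"
      using B(3) by (intro F.span_minimal dual_space_subspace) auto
    show "dual_space s V \<subseteq> F.span (e ` B)"
    proof
      fix \<phi> assume \<phi>: "\<phi> \<in> dual_space s V"
      have "(\<Sum>b\<in>B. fun_scale (\<phi> b) (e b)) \<in> F.span (e ` B)"
        by (rule F.span_sum, rule F.span_scale, rule F.span_base) (rule imageI)
      then show "\<phi> \<in> F.span (e ` B)"
        by (simp only: expand[OF \<phi>, symmetric])
    qed
  qed
  then show ?thesis using B(1) F.vector_space_axioms by (auto simp: fd_space_def)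
qed

lemma neg_predual_pairing:
  assumes V: "fd_space s V"
    and F: "linear_on fun_scale (dual_space s V) fun_scale (dual_space s V) F" and x: "x \<in> V"
  shows "neg_predual s V F x \<in> V" "\<eta> \<in> dual_space s V \<Longrightarrow> \<eta> (neg_predual s V F x) = - F \<eta> x"
proof -
  interpret S: vector_space s using V by (simp add: fd_space_def)
  have sub: "S.subspace V" using V by (rule fd_space_subspace)
  obtain B e where B: "finite B" "B \<subseteq> V" "\<And>b. b \<in> B \<Longrightarrow> e b \<in> dual_space s V"
    "\<And>v. v \<in> V \<Longrightarrow> v = (\<Sum>b\<in>B. s (e b v) b)"
    by (rule fd_space_dual_basis[OF V]) blast
  define y where "y = (\<Sum>b\<in>B. s (- F (e b) x) b)"
  have yV: "y \<in> V" unfolding y_def using B(2)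
    by (intro S.subspace_sum[OF sub] S.subspace_scale[OF sub]) auto
  have y: "\<eta> y = - F \<eta> x" if \<eta>: "\<eta> \<in> dual_space s V" for \<eta>
  proof -
    have sum_ev: "(\<Sum>b\<in>B. fun_scale (c b) (g b)) v = (\<Sum>b\<in>B. c b * g b v)" for c g and v :: 'b
      using B(1) by (induction B rule: finite_induct) (auto simp: fun_scale_def)
    have "\<eta> = (\<Sum>b\<in>B. fun_scale (\<eta> b) (e b))"
    proof
      fix v show "\<eta> v = (\<Sum>b\<in>B. fun_scale (\<eta> b) (e b)) v"
        unfolding sum_ev using functional_expand[OF V \<eta> B(1,2) B(4), of v] \<eta> B(3)
        by (cases "v \<in> V") (auto simp: mult.commute dual_space_def)
    qed
    then have "F \<eta> = F (\<Sum>b\<in>B. fun_scale (\<eta> b) (e b))" by (rule arg_cong)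
    also have "\<dots> = (\<Sum>b\<in>B. fun_scale (\<eta> b) (F (e b)))"
      by (rule linear_on_sum[OF F vector_space_fun_scale dual_space_subspace vector_space_fun_scale B(1) B(3)])
    finally have "F \<eta> x = (\<Sum>b\<in>B. \<eta> b * F (e b) x)" by (simp add: sum_ev)
    moreover have "\<eta> y = (\<Sum>b\<in>B. - F (e b) x * \<eta> b)"
      using functional_expand[OF V \<eta> B(1,2) y_def] .
    ultimately show ?thesis by (simp add: sum_negf mult.commute)
  qed
  have uniq: "z = y" if "z \<in> V" "\<forall>\<eta>\<in>dual_space s V. \<eta> z = - F \<eta> x" for z
  proof -
    have "e b z = e b y" if "b \<in> B" for b
      using \<open>\<forall>\<eta>\<in>dual_space s V. \<eta> z = - F \<eta> x\<close> y[OF B(3)[OF that]] B(3)[OF that] by simp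
    then have "(\<Sum>b\<in>B. s (e b z) b) = (\<Sum>b\<in>B. s (e b y) b)" by (intro sum.cong) auto
    then show ?thesis unfolding B(4)[OF that(1), symmetric] B(4)[OF yV, symmetric] .
  qed
  have "neg_predual s V F x = y"
    unfolding neg_predual_def
  proof (rule the_equality)
    show "y \<in> V \<and> (\<forall>\<eta>\<in>dual_space s V. \<eta> y = - F \<eta> x)" using yV y by blast
  qed (use uniq in blast)
  then show "neg_predual s V F x \<in> V" "\<eta> \<in> dual_space s V \<Longrightarrow> \<eta> (neg_predual s V F x) = - F \<eta> x"
    using yV y by simp_all
qed

section \<open>Tensor squares\<close>

text \<open>
  For finite-dimensional \<open>V\<close>, the tensor square is realised inside the bilinear forms on the dual
  space: \<open>v \<otimes> w\<close> is the form sending \<open>(\<phi>, \<psi>)\<close> to \<open>\<phi> v * \<psi> w\<close>, and the tensor square is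
  the span of these. Hence \<open>T \<phi> \<psi>\<close> is the pairing of \<open>T\<close> with \<open>\<phi> \<otimes> \<psi>\<close>. The universal property
  is proved below.
\<close>

definition pure_tensor :: "('k::field \<Rightarrow> 'v::ab_group_add \<Rightarrow> 'v) \<Rightarrow> 'v set \<Rightarrow> 'v \<Rightarrow> 'v \<Rightarrow>
    ('v \<Rightarrow> 'k) \<Rightarrow> ('v \<Rightarrow> 'k) \<Rightarrow> 'k" where
  "pure_tensor s V v w = (\<lambda>\<phi> \<psi>. eval_at s V v \<phi> * eval_at s V w \<psi>)"

definition tensor_scale :: "'k::field \<Rightarrow> ('a \<Rightarrow> 'b \<Rightarrow> 'k) \<Rightarrow> 'a \<Rightarrow> 'b \<Rightarrow> 'k" where
  "tensor_scale c T = (\<lambda>\<phi> \<psi>. c * T \<phi> \<psi>)"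

definition tensor_square :: "('k::field \<Rightarrow> 'v::ab_group_add \<Rightarrow> 'v) \<Rightarrow> 'v set \<Rightarrow>
    (('v \<Rightarrow> 'k) \<Rightarrow> ('v \<Rightarrow> 'k) \<Rightarrow> 'k) set" where
  "tensor_square s V = module.span tensor_scale {pure_tensor s V v w | v w. v \<in> V \<and> w \<in> V}"

text \<open>The operator \<open>A \<otimes> B\<close> on the tensor square; see \<open>tensor_map_pure\<close>.\<close>

definition tensor_map :: "('k::field \<Rightarrow> 'v::ab_group_add \<Rightarrow> 'v) \<Rightarrow> 'v set \<Rightarrow>
    ('v \<Rightarrow> 'v) \<Rightarrow> ('v \<Rightarrow> 'v) \<Rightarrow> (('v \<Rightarrow> 'k) \<Rightarrow> ('v \<Rightarrow> 'k) \<Rightarrow> 'k) \<Rightarrow> ('v \<Rightarrow> 'k) \<Rightarrow> ('v \<Rightarrow> 'k) \<Rightarrow> 'k" where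
  "tensor_map s V A B T = (\<lambda>\<phi> \<psi>. if \<phi> \<in> dual_space s V \<and> \<psi> \<in> dual_space s V
     then T (transpose_on V A \<phi>) (transpose_on V B \<psi>) else 0)"

lemma vector_space_tensor_scale: "vector_space (tensor_scale :: 'k::field \<Rightarrow> ('a \<Rightarrow> 'b \<Rightarrow> 'k) \<Rightarrow> _)"
  by unfold_locales (auto simp: tensor_scale_def fun_eq_iff algebra_simps)

lemma bilinear_on_pure_tensor:
  "bilinear_on s V s V tensor_scale (tensor_square s V) (pure_tensor s V)"
proof -
  interpret T: vector_space "tensor_scale :: 'a \<Rightarrow> (('b \<Rightarrow> 'a) \<Rightarrow> ('b \<Rightarrow> 'a) \<Rightarrow> 'a) \<Rightarrow> _"
    by (rule vector_space_tensor_scale)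
  have "pure_tensor s V v w \<in> tensor_square s V" if "v \<in> V" "w \<in> V" for v w
    unfolding tensor_square_def by (rule T.span_base) (use that in blast)
  moreover have "eval_at s V (v + w) \<phi> = eval_at s V v \<phi> + eval_at s V w \<phi>"
    "eval_at s V (s c v) \<phi> = c * eval_at s V v \<phi>" if "v \<in> V" "w \<in> V" for c v w \<phi>
    using that by (auto simp: eval_at_def dual_space_def linear_on_def)
  ultimately show ?thesis
    by (simp add: bilinear_on_def linear_on_def pure_tensor_def tensor_scale_def fun_eq_iff
        distrib_left distrib_right mult.assoc mult.left_commute)
qed

lemma tensor_map_pure:
  assumes "linear_on s V s V A" "linear_on s V s V B" "module.subspace s V" "vector_space s"
    "v \<in> V" "w \<in> V"
  shows "tensor_map s V A B (pure_tensor s V v w) = pure_tensor s V (A v) (B w)"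
proof -
  interpret S: vector_space s by fact
  have "transpose_on V C \<phi> \<in> dual_space s V"
    if "\<phi> \<in> dual_space s V" "linear_on s V s V C" for C \<phi>
    using that S.subspace_add[OF assms(3)] S.subspace_scale[OF assms(3)]
    by (auto simp: dual_space_def transpose_on_def linear_on_def)
  then show ?thesis using assms
    by (auto simp: tensor_map_def pure_tensor_def eval_at_def transpose_on_def fun_eq_iff)
qed

lemma tensor_map_add: "tensor_map s V A B (T + T') = tensor_map s V A B T + tensor_map s V A B T'"
  and tensor_map_scale: "tensor_map s V A B (tensor_scale c T) = tensor_scale c (tensor_map s V A B T)"
  by (auto simp: tensor_map_def tensor_scale_def fun_eq_iff)

text \<open>The universal property of the tensor square.\<close>

lemma tensor_square_universal:
  assumes V: "fd_space s V" and t: "vector_space t" and W: "module.subspace t W"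
    and f: "bilinear_on s V s V t W f"
  shows "\<exists>F. linear_on tensor_scale (tensor_square s V) t W F \<and>
           (\<forall>v\<in>V. \<forall>w\<in>V. F (pure_tensor s V v w) = f v w)"
proof -
  interpret S: vector_space s using V by (simp add: fd_space_def)
  interpret W: vector_space t by fact
  have sub: "S.subspace V" using V by (rule fd_space_subspace)
  obtain B e where B: "finite B" "B \<subseteq> V" "\<And>b. b \<in> B \<Longrightarrow> e b \<in> dual_space s V"
    "\<And>v. v \<in> V \<Longrightarrow> v = (\<Sum>b\<in>B. s (e b v) b)"
    by (rule fd_space_dual_basis[OF V]) blast
  define F where "F T = (\<Sum>b\<in>B. \<Sum>c\<in>B. t (T (e b) (e c)) (f b c))" for T
  have fW: "f b c \<in> W" if "b \<in> V" "c \<in> V" for b c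
    using f that by (auto simp: bilinear_on_def linear_on_def)
  have "linear_on tensor_scale (tensor_square s V) t W F"
    unfolding linear_on_def
  proof (intro conjI ballI allI)
    show "F T \<in> W" for T
      unfolding F_def using B(2) by (intro W.subspace_sum[OF W] W.subspace_scale[OF W] fW) auto
    show "F (T + T') = F T + F T'" for T T'
      by (simp add: F_def W.scale_left_distrib sum.distrib)
    show "F (tensor_scale c T) = t c (F T)" for c T
      by (simp add: F_def tensor_scale_def W.scale_sum_right)
  qed
  moreover have "F (pure_tensor s V v w) = f v w" if v: "v \<in> V" and w: "w \<in> V" for v w
  proof -
    have "f v w = f (\<Sum>b\<in>B. s (e b v) b) w" by (rule arg_cong[where f = "\<lambda>x. f x w", OF B(4)[OF v]])
    also have "\<dots> = (\<Sum>b\<in>B. t (e b v) (f b w))"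
      using f w B(1,2) by (intro linear_on_sum[of s V t W "\<lambda>x. f x w"])
        (auto simp: bilinear_on_def sub S.vector_space_axioms t)
    also have "\<dots> = (\<Sum>b\<in>B. t (e b v) (\<Sum>c\<in>B. t (e c w) (f b c)))"
    proof (rule sum.cong[OF refl])
      fix b assume b: "b \<in> B"
      have "f b w = f b (\<Sum>c\<in>B. s (e c w) c)" by (rule arg_cong[OF B(4)[OF w]])
      also have "\<dots> = (\<Sum>c\<in>B. t (e c w) (f b c))"
        using f b B(1,2) by (intro linear_on_sum[of s V t W "f b"])
          (auto simp: bilinear_on_def sub S.vector_space_axioms t)
      finally show "t (e b v) (f b w) = t (e b v) (\<Sum>c\<in>B. t (e c w) (f b c))" by simp
    qed
    also have "\<dots> = F (pure_tensor s V v w)"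
      using B(3) by (simp add: F_def pure_tensor_def eval_at_def W.scale_sum_right)
    finally show ?thesis by simp
  qed
  ultimately show ?thesis by blast
qed

section \<open>Mock-Lie algebras\<close>

definition mock_lie :: "('k::field \<Rightarrow> 'v::ab_group_add \<Rightarrow> 'v) \<Rightarrow> 'v set \<Rightarrow> ('v \<Rightarrow> 'v \<Rightarrow> 'v) \<Rightarrow> bool" where
  "mock_lie s V b \<longleftrightarrow> fd_space s V \<and> bilinear_on s V s V s V b \<and>
     (\<forall>x\<in>V. \<forall>y\<in>V. b x y = b y x) \<and>
     (\<forall>x\<in>V. \<forall>y\<in>V. \<forall>z\<in>V. b x (b y z) + b y (b z x) + b z (b x y) = 0)"

text \<open>Bilinearity of \<open>\<rho>\<close> says that \<open>\<rho>\<close> is a linear map into the endomorphisms of \<open>W\<close>.\<close>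

definition mock_lie_rep :: "('k::field \<Rightarrow> 'v::ab_group_add \<Rightarrow> 'v) \<Rightarrow> 'v set \<Rightarrow> ('v \<Rightarrow> 'v \<Rightarrow> 'v) \<Rightarrow>
    ('k \<Rightarrow> 'w::ab_group_add \<Rightarrow> 'w) \<Rightarrow> 'w set \<Rightarrow> ('v \<Rightarrow> 'w \<Rightarrow> 'w) \<Rightarrow> bool" where
  "mock_lie_rep s V b t W \<rho> \<longleftrightarrow> mock_lie s V b \<and> fd_space t W \<and> bilinear_on s V t W t W \<rho> \<and>
     (\<forall>x\<in>V. \<forall>y\<in>V. \<forall>w\<in>W. \<rho> (b x y) w = - \<rho> x (\<rho> y w) - \<rho> y (\<rho> x w))"

definition mock_lie_matched_pair :: "('k::field \<Rightarrow> 'v::ab_group_add \<Rightarrow> 'v) \<Rightarrow> 'v set \<Rightarrow> ('v \<Rightarrow> 'v \<Rightarrow> 'v) \<Rightarrow>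
    ('k \<Rightarrow> 'w::ab_group_add \<Rightarrow> 'w) \<Rightarrow> 'w set \<Rightarrow> ('w \<Rightarrow> 'w \<Rightarrow> 'w) \<Rightarrow>
    ('v \<Rightarrow> 'w \<Rightarrow> 'w) \<Rightarrow> ('w \<Rightarrow> 'v \<Rightarrow> 'v) \<Rightarrow> bool" where
  "mock_lie_matched_pair s V bg t W bh \<rho> \<mu> \<longleftrightarrow>
     mock_lie s V bg \<and> mock_lie t W bh \<and>
     mock_lie_rep s V bg t W \<rho> \<and> mock_lie_rep t W bh s V \<mu> \<and>
     (\<forall>x\<in>V. \<forall>u\<in>W. \<forall>v\<in>W.
        \<rho> x (bh u v) + bh (\<rho> x u) v + bh u (\<rho> x v) + \<rho> (\<mu> u x) v + \<rho> (\<mu> v x) u = 0) \<and>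
     (\<forall>x\<in>V. \<forall>y\<in>V. \<forall>u\<in>W.
        \<mu> u (bg x y) + bg (\<mu> u x) y + bg x (\<mu> u y) + \<mu> (\<rho> x u) y + \<mu> (\<rho> y u) x = 0)"

section \<open>Mock-pre-Lie algebras\<close>

definition mock_pre_lie :: "('k::field \<Rightarrow> 'v::ab_group_add \<Rightarrow> 'v) \<Rightarrow> 'v set \<Rightarrow> ('v \<Rightarrow> 'v \<Rightarrow> 'v) \<Rightarrow> bool" where
  "mock_pre_lie s V m \<longleftrightarrow> fd_space s V \<and> bilinear_on s V s V s V m \<and>
     (\<forall>x\<in>V. \<forall>y\<in>V. \<forall>z\<in>V. m (m x y) z + m x (m y z) = - m (m y x) z - m y (m x z))"

definition subadj :: "('v::ab_group_add \<Rightarrow> 'v \<Rightarrow> 'v) \<Rightarrow> 'v \<Rightarrow> 'v \<Rightarrow> 'v" where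
  "subadj m x y = m x y + m y x"

text \<open>Left multiplication by \<open>x\<close> is \<open>m x\<close>; right multiplication by \<open>x\<close> is \<open>rmul m x\<close>.\<close>

definition rmul :: "('v \<Rightarrow> 'v \<Rightarrow> 'v) \<Rightarrow> 'v \<Rightarrow> 'v \<Rightarrow> 'v" where
  "rmul m x y = m y x"

definition mock_pre_lie_rep :: "('k::field \<Rightarrow> 'v::ab_group_add \<Rightarrow> 'v) \<Rightarrow> 'v set \<Rightarrow> ('v \<Rightarrow> 'v \<Rightarrow> 'v) \<Rightarrow>
    ('k \<Rightarrow> 'w::ab_group_add \<Rightarrow> 'w) \<Rightarrow> 'w set \<Rightarrow> ('v \<Rightarrow> 'w \<Rightarrow> 'w) \<Rightarrow> ('v \<Rightarrow> 'w \<Rightarrow> 'w) \<Rightarrow> bool" where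
  "mock_pre_lie_rep s V m t W \<rho> \<mu> \<longleftrightarrow>
     mock_pre_lie s V m \<and> mock_lie_rep s V (subadj m) t W \<rho> \<and> bilinear_on s V t W t W \<mu> \<and>
     (\<forall>x\<in>V. \<forall>y\<in>V. \<forall>w\<in>W. \<rho> x (\<mu> y w) + \<mu> y (\<rho> x w) = - \<mu> (m x y) w - \<mu> y (\<mu> x w))"

definition mock_pre_lie_matched_pair :: "('k::field \<Rightarrow> 'v::ab_group_add \<Rightarrow> 'v) \<Rightarrow> 'v set \<Rightarrow> ('v \<Rightarrow> 'v \<Rightarrow> 'v) \<Rightarrow>
    ('k \<Rightarrow> 'w::ab_group_add \<Rightarrow> 'w) \<Rightarrow> 'w set \<Rightarrow> ('w \<Rightarrow> 'w \<Rightarrow> 'w) \<Rightarrow>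
    ('v \<Rightarrow> 'w \<Rightarrow> 'w) \<Rightarrow> ('v \<Rightarrow> 'w \<Rightarrow> 'w) \<Rightarrow> ('w \<Rightarrow> 'v \<Rightarrow> 'v) \<Rightarrow> ('w \<Rightarrow> 'v \<Rightarrow> 'v) \<Rightarrow> bool" where
  "mock_pre_lie_matched_pair s V mg t W mh \<rho>g \<mu>g \<rho>h \<mu>h \<longleftrightarrow>
     mock_pre_lie s V mg \<and> mock_pre_lie t W mh \<and>
     mock_pre_lie_rep s V mg t W \<rho>g \<mu>g \<and> mock_pre_lie_rep t W mh s V \<rho>h \<mu>h \<and>
     (\<forall>x\<in>V. \<forall>y\<in>V. \<forall>u\<in>W.
        0 = \<mu>h u (subadj mg x y) + \<mu>h (\<rho>g y u) x + \<mu>h (\<rho>g x u) y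
            + mg x (\<mu>h u y) + mg y (\<mu>h u x)) \<and>
     (\<forall>x\<in>V. \<forall>u\<in>W. \<forall>v\<in>W.
        0 = \<mu>g x (subadj mh u v) + \<mu>g (\<rho>h v x) u + \<mu>g (\<rho>h u x) v
            + mh u (\<mu>g x v) + mh v (\<mu>g x u)) \<and>
     (\<forall>x\<in>V. \<forall>y\<in>V. \<forall>u\<in>W.
        - \<rho>h u (mg x y) = \<rho>h (\<rho>g x u + \<mu>g x u) y + mg (\<rho>h u x + \<mu>h u x) y
            + \<mu>h (\<mu>g y u) x + mg x (\<rho>h u y)) \<and>
     (\<forall>x\<in>V. \<forall>u\<in>W. \<forall>v\<in>W.
        - \<rho>g x (mh u v) = \<rho>g (\<rho>h u x + \<mu>h u x) v + mh (\<rho>g x u + \<mu>g x u) v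
            + \<mu>g (\<mu>h v x) u + mh u (\<rho>g x v))"

section \<open>Bialgebras\<close>

text \<open>\<open>\<alpha>\<close> is the dual map of a product on the dual space of \<open>V\<close>.\<close>

definition dual_of_dual_product :: "('k::field \<Rightarrow> 'v::ab_group_add \<Rightarrow> 'v) \<Rightarrow> 'v set \<Rightarrow>
    (('v \<Rightarrow> 'k) \<Rightarrow> ('v \<Rightarrow> 'k) \<Rightarrow> ('v \<Rightarrow> 'k)) \<Rightarrow> ('v \<Rightarrow> ('v \<Rightarrow> 'k) \<Rightarrow> ('v \<Rightarrow> 'k) \<Rightarrow> 'k) \<Rightarrow> bool" where
  "dual_of_dual_product s V md \<alpha> \<longleftrightarrow>
     linear_on s V tensor_scale (tensor_square s V) \<alpha> \<and>
     (\<forall>x\<in>V. \<forall>\<xi>\<in>dual_space s V. \<forall>\<eta>\<in>dual_space s V. \<alpha> x \<xi> \<eta> = md \<xi> \<eta> x)"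

text \<open>
  \<open>\<beta>\<close> is the dual map of a product on \<open>V\<close>. Elements of the tensor square of the dual space are
  forms on the bidual, and are paired with \<open>x \<otimes> y\<close> through the canonical embedding.
\<close>

definition dual_of_product :: "('k::field \<Rightarrow> 'v::ab_group_add \<Rightarrow> 'v) \<Rightarrow> 'v set \<Rightarrow>
    ('v \<Rightarrow> 'v \<Rightarrow> 'v) \<Rightarrow> (('v \<Rightarrow> 'k) \<Rightarrow> (('v \<Rightarrow> 'k) \<Rightarrow> 'k) \<Rightarrow> (('v \<Rightarrow> 'k) \<Rightarrow> 'k) \<Rightarrow> 'k) \<Rightarrow> bool" where
  "dual_of_product s V m \<beta> \<longleftrightarrow>
     linear_on fun_scale (dual_space s V) tensor_scale (tensor_square fun_scale (dual_space s V)) \<beta> \<and>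
     (\<forall>\<xi>\<in>dual_space s V. \<forall>x\<in>V. \<forall>y\<in>V. \<beta> \<xi> (eval_at s V x) (eval_at s V y) = \<xi> (m x y))"

definition coproduct_compatible :: "('k::field \<Rightarrow> 'v::ab_group_add \<Rightarrow> 'v) \<Rightarrow> 'v set \<Rightarrow>
    ('v \<Rightarrow> 'v \<Rightarrow> 'v) \<Rightarrow> ('v \<Rightarrow> ('v \<Rightarrow> 'k) \<Rightarrow> ('v \<Rightarrow> 'k) \<Rightarrow> 'k) \<Rightarrow> bool" where
  "coproduct_compatible s V m \<Delta> \<longleftrightarrow> (\<forall>x\<in>V. \<forall>y\<in>V.
     \<Delta> (subadj m x y) =
       - (tensor_map s V id (\<lambda>z. rmul m y z + m y z) (\<Delta> x) + tensor_map s V (m y) id (\<Delta> x))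
       - (tensor_map s V id (\<lambda>z. m x z + rmul m x z) (\<Delta> y) + tensor_map s V (m x) id (\<Delta> y)))"

text \<open>
  The products \<open>m\<close> and \<open>md\<close> are determined by \<open>\<beta>\<close> and \<open>\<alpha>\<close>, whose dual maps they are.
\<close>

definition mock_pre_lie_bialgebra :: "('k::field \<Rightarrow> 'v::ab_group_add \<Rightarrow> 'v) \<Rightarrow> 'v set \<Rightarrow>
    ('v \<Rightarrow> 'v \<Rightarrow> 'v) \<Rightarrow> (('v \<Rightarrow> 'k) \<Rightarrow> ('v \<Rightarrow> 'k) \<Rightarrow> ('v \<Rightarrow> 'k)) \<Rightarrow>
    ('v \<Rightarrow> ('v \<Rightarrow> 'k) \<Rightarrow> ('v \<Rightarrow> 'k) \<Rightarrow> 'k) \<Rightarrow>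
    (('v \<Rightarrow> 'k) \<Rightarrow> (('v \<Rightarrow> 'k) \<Rightarrow> 'k) \<Rightarrow> (('v \<Rightarrow> 'k) \<Rightarrow> 'k) \<Rightarrow> 'k) \<Rightarrow> bool" where
  "mock_pre_lie_bialgebra s V m md \<alpha> \<beta> \<longleftrightarrow>
     dual_of_dual_product s V md \<alpha> \<and> dual_of_product s V m \<beta> \<and>
     mock_pre_lie fun_scale (dual_space s V) md \<and> mock_pre_lie s V m \<and>
     coproduct_compatible s V m \<alpha> \<and>
     coproduct_compatible fun_scale (dual_space s V) md \<beta>"

section \<open>Invariant and symplectic forms\<close>

definition skew_nondegenerate :: "('k::field \<Rightarrow> 'v::ab_group_add \<Rightarrow> 'v) \<Rightarrow> 'v set \<Rightarrow> ('v \<Rightarrow> 'v \<Rightarrow> 'k) \<Rightarrow> bool" where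
  "skew_nondegenerate s V \<omega> \<longleftrightarrow> bilinear_on s V s V (*) UNIV \<omega> \<and>
     (\<forall>x\<in>V. \<forall>y\<in>V. \<omega> x y = - \<omega> y x) \<and>
     (\<forall>x\<in>V. (\<forall>y\<in>V. \<omega> x y = 0) \<longrightarrow> x = 0)"

definition quadratic_mock_pre_lie :: "('k::field \<Rightarrow> 'v::ab_group_add \<Rightarrow> 'v) \<Rightarrow> 'v set \<Rightarrow>
    ('v \<Rightarrow> 'v \<Rightarrow> 'v) \<Rightarrow> ('v \<Rightarrow> 'v \<Rightarrow> 'k) \<Rightarrow> bool" where
  "quadratic_mock_pre_lie s V m \<omega> \<longleftrightarrow> mock_pre_lie s V m \<and> skew_nondegenerate s V \<omega> \<and>
     (\<forall>x\<in>V. \<forall>y\<in>V. \<forall>z\<in>V. \<omega> (m x y) z = \<omega> y (m x z + m z x))"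

definition symplectic_mock_lie :: "('k::field \<Rightarrow> 'v::ab_group_add \<Rightarrow> 'v) \<Rightarrow> 'v set \<Rightarrow>
    ('v \<Rightarrow> 'v \<Rightarrow> 'v) \<Rightarrow> ('v \<Rightarrow> 'v \<Rightarrow> 'k) \<Rightarrow> bool" where
  "symplectic_mock_lie s V b \<omega> \<longleftrightarrow> mock_lie s V b \<and> skew_nondegenerate s V \<omega> \<and>
     (\<forall>x\<in>V. \<forall>y\<in>V. \<forall>z\<in>V. \<omega> (b x y) z + \<omega> (b y z) x + \<omega> (b z x) y = 0)"

definition subalgebra :: "('k::field \<Rightarrow> 'v::ab_group_add \<Rightarrow> 'v) \<Rightarrow> 'v set \<Rightarrow> ('v \<Rightarrow> 'v \<Rightarrow> 'v) \<Rightarrow> 'v set \<Rightarrow> bool" where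
  "subalgebra s V m A \<longleftrightarrow> A \<subseteq> V \<and> module.subspace s A \<and> (\<forall>x\<in>A. \<forall>y\<in>A. m x y \<in> A)"

definition manin_triple :: "('k::field \<Rightarrow> 'v::ab_group_add \<Rightarrow> 'v) \<Rightarrow> 'v set \<Rightarrow>
    ('v \<Rightarrow> 'v \<Rightarrow> 'v) \<Rightarrow> ('v \<Rightarrow> 'v \<Rightarrow> 'k) \<Rightarrow> 'v set \<Rightarrow> 'v set \<Rightarrow> bool" where
  "manin_triple s V m \<omega> A B \<longleftrightarrow> quadratic_mock_pre_lie s V m \<omega> \<and>
     subalgebra s V m A \<and> subalgebra s V m B \<and>
     V = {a + b | a b. a \<in> A \<and> b \<in> B} \<and> A \<inter> B = {0} \<and>
     (\<forall>x\<in>A. \<forall>y\<in>A. \<omega> x y = 0) \<and> (\<forall>x\<in>B. \<forall>y\<in>B. \<omega> x y = 0)"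

section \<open>The double \<open>V \<oplus> V\<^sup>*\<close>\<close>

definition double_space :: "('k::field \<Rightarrow> 'v::ab_group_add \<Rightarrow> 'v) \<Rightarrow> 'v set \<Rightarrow> ('v \<times> ('v \<Rightarrow> 'k)) set" where
  "double_space s V = V \<times> dual_space s V"

definition double_scale :: "('k::field \<Rightarrow> 'v::ab_group_add \<Rightarrow> 'v) \<Rightarrow> 'k \<Rightarrow>
    'v \<times> ('v \<Rightarrow> 'k) \<Rightarrow> 'v \<times> ('v \<Rightarrow> 'k)" where
  "double_scale s = module_prod.scale s fun_scale"

definition double_form :: "'v \<times> ('v \<Rightarrow> 'k::field) \<Rightarrow> 'v \<times> ('v \<Rightarrow> 'k) \<Rightarrow> 'k" where
  "double_form = (\<lambda>(x, \<xi>) (y, \<eta>). \<xi> y - \<eta> x)"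

definition phase_space :: "('k::field \<Rightarrow> 'v::ab_group_add \<Rightarrow> 'v) \<Rightarrow> 'v set \<Rightarrow> ('v \<Rightarrow> 'v \<Rightarrow> 'v) \<Rightarrow>
    ('v \<times> ('v \<Rightarrow> 'k) \<Rightarrow> 'v \<times> ('v \<Rightarrow> 'k) \<Rightarrow> 'v \<times> ('v \<Rightarrow> 'k)) \<Rightarrow>
    ('v \<times> ('v \<Rightarrow> 'k) \<Rightarrow> 'v \<times> ('v \<Rightarrow> 'k) \<Rightarrow> 'k) \<Rightarrow> bool" where
  "phase_space s V b B \<omega> \<longleftrightarrow> mock_lie s V b \<and>
     symplectic_mock_lie (double_scale s) (double_space s V) B \<omega> \<and>
     (\<forall>p\<in>double_space s V. \<forall>q\<in>double_space s V. \<omega> p q = double_form p q) \<and>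
     subalgebra (double_scale s) (double_space s V) B (V \<times> {0}) \<and>
     (\<forall>x\<in>V. \<forall>y\<in>V. B (x, 0) (y, 0) = (b x y, 0)) \<and>
     subalgebra (double_scale s) (double_space s V) B ({0} \<times> dual_space s V)"

definition Lstar :: "'v set \<Rightarrow> ('v \<Rightarrow> 'v \<Rightarrow> 'v) \<Rightarrow> 'v \<Rightarrow> ('v \<Rightarrow> 'k::field) \<Rightarrow> 'v \<Rightarrow> 'k" where
  "Lstar V m x = neg_dual V (m x)"

definition Rstar :: "'v set \<Rightarrow> ('v \<Rightarrow> 'v \<Rightarrow> 'v) \<Rightarrow> 'v \<Rightarrow> ('v \<Rightarrow> 'k::field) \<Rightarrow> 'v \<Rightarrow> 'k" where
  "Rstar V m x = neg_dual V (rmul m x)"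

definition dual_Lstar :: "('k::field \<Rightarrow> 'v::ab_group_add \<Rightarrow> 'v) \<Rightarrow> 'v set \<Rightarrow>
    (('v \<Rightarrow> 'k) \<Rightarrow> ('v \<Rightarrow> 'k) \<Rightarrow> ('v \<Rightarrow> 'k)) \<Rightarrow> ('v \<Rightarrow> 'k) \<Rightarrow> 'v \<Rightarrow> 'v" where
  "dual_Lstar s V md \<xi> = neg_predual s V (md \<xi>)"

definition dual_Rstar :: "('k::field \<Rightarrow> 'v::ab_group_add \<Rightarrow> 'v) \<Rightarrow> 'v set \<Rightarrow>
    (('v \<Rightarrow> 'k) \<Rightarrow> ('v \<Rightarrow> 'k) \<Rightarrow> ('v \<Rightarrow> 'k)) \<Rightarrow> ('v \<Rightarrow> 'k) \<Rightarrow> 'v \<Rightarrow> 'v" where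
  "dual_Rstar s V md \<xi> = neg_predual s V (rmul md \<xi>)"

definition double_bracket :: "('k::field \<Rightarrow> 'v::ab_group_add \<Rightarrow> 'v) \<Rightarrow> 'v set \<Rightarrow>
    ('v \<Rightarrow> 'v \<Rightarrow> 'v) \<Rightarrow> (('v \<Rightarrow> 'k) \<Rightarrow> ('v \<Rightarrow> 'k) \<Rightarrow> ('v \<Rightarrow> 'k)) \<Rightarrow>
    'v \<times> ('v \<Rightarrow> 'k) \<Rightarrow> 'v \<times> ('v \<Rightarrow> 'k) \<Rightarrow> 'v \<times> ('v \<Rightarrow> 'k)" where
  "double_bracket s V m md = (\<lambda>(x, \<xi>) (y, \<eta>).
     (subadj m x y - dual_Lstar s V md \<xi> y - dual_Lstar s V md \<eta> x,
      subadj md \<xi> \<eta> - Lstar V m x \<eta> - Lstar V m y \<xi>))"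

end

theory Submission
  imports Defs
begin

text \<open>
  Pairing with functionals turns the compatibility conditions of the bialgebra into two families of
  scalar identities, and the conditions of either kind of matched pair are the same identities paired
  with a further vector or functional; the representation properties hold automatically. The double bracket
  is always compatible with the form, so the phase space condition is the Jacobi identity of the
  double, whose mixed components are the matched pair conditions. Finally, an invariant form on a
  mock-pre-Lie algebra is symplectic for the sub-adjacent bracket, and conversely a symplectic form
  determines a mock-pre-Lie product whose left multiplications are the adjoints of those of the
  bracket; on the double this matches phase spaces with Manin triples.
\<close>

section \<open>Linear and bilinear maps on carriers\<close>

lemma linear_on_diff:
  assumes "linear_on s V t W f" "vector_space s" "module.subspace s V" "vector_space t"
    "x \<in> V" "y \<in> V"
  shows "f (x - y) = f x - f y"
proof -
  interpret S: vector_space s by fact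
  have "x - y \<in> V" by (rule S.subspace_diff[OF assms(3,5,6)])
  then have "f (x - y + y) = f (x - y) + f y"
    using assms(1,6) unfolding linear_on_def by blast
  then show ?thesis by (simp add: algebra_simps)
qed

lemma linear_on_zero:
  assumes "linear_on s V t W f" "vector_space s" "module.subspace s V" "vector_space t"
  shows "f 0 = 0"
proof -
  interpret S: vector_space s by fact
  show ?thesis using linear_on_diff[OF assms S.subspace_0 S.subspace_0] assms(3) by simp
qed

lemma linear_on_uminus:
  assumes "linear_on s V t W f" "vector_space s" "module.subspace s V" "vector_space t" "x \<in> V"
  shows "f (- x) = - f x"
proof -
  interpret S: vector_space s by fact
  show ?thesis
    using linear_on_diff[OF assms(1-4) S.subspace_0 assms(5)] linear_on_zero[OF assms(1-4)] assms(3)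
    by simp
qed

section \<open>Functionals on the carrier and their transposes\<close>

lemma dual_space_linear: "\<xi> \<in> dual_space s V \<Longrightarrow> linear_on s V (*) UNIV \<xi>"
  by (simp add: dual_space_def)

text \<open>The coordinates of a vector are its values under the functionals of a dual basis, so two
  vectors with equal values are the same linear combination.\<close>

lemma dual_space_separates:
  assumes "fd_space s V" "x \<in> V" "y \<in> V" "\<And>\<xi>. \<xi> \<in> dual_space s V \<Longrightarrow> \<xi> x = \<xi> y"
  shows "x = y"
proof -
  obtain B e where B: "\<And>b. b \<in> B \<Longrightarrow> e b \<in> dual_space s V"
    "\<And>v. v \<in> V \<Longrightarrow> v = (\<Sum>b\<in>B. s (e b v) b)"
    by (rule fd_space_dual_basis[OF assms(1)]) blast
  have "(\<Sum>b\<in>B. s (e b x) b) = (\<Sum>b\<in>B. s (e b y) b)"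
    using assms(4)[OF B(1)] by simp
  then show ?thesis unfolding B(2)[OF assms(2), symmetric] B(2)[OF assms(3), symmetric] .
qed

text \<open>Off \<open>V\<close> both functionals are zero by the convention built into
  \<open>dual_space\<close>, so agreement on \<open>V\<close> is equality of functions.\<close>

lemma dual_space_eqI:
  assumes "\<xi> \<in> dual_space s V" "\<eta> \<in> dual_space s V" "\<And>x. x \<in> V \<Longrightarrow> \<xi> x = \<eta> x"
  shows "\<xi> = \<eta>"
proof
  show "\<xi> x = \<eta> x" for x
    using assms by (cases "x \<in> V") (auto simp: dual_space_def)
qed

lemma transpose_on_in_dual_space:
  assumes "fd_space s V" "linear_on s V s V A" "\<xi> \<in> dual_space s V"
  shows "transpose_on V A \<xi> \<in> dual_space s V"
proof -
  interpret S: vector_space s using assms(1) by (simp add: fd_space_def)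
  have sub: "S.subspace V" using assms(1) by (rule fd_space_subspace)
  show ?thesis
    using assms(2,3) S.subspace_add[OF sub] S.subspace_scale[OF sub]
    by (auto simp: dual_space_def transpose_on_def linear_on_def)
qed

lemma transpose_on_id: "\<xi> \<in> dual_space s V \<Longrightarrow> transpose_on V id \<xi> = \<xi>"
  by (auto simp: transpose_on_def dual_space_def)

lemma neg_dual_eq_transpose: "neg_dual V A \<xi> = - transpose_on V A \<xi>"
  by (auto simp: neg_dual_def transpose_on_def)

section \<open>The bidual and tensor squares\<close>

lemma eval_at_in_bidual:
  fixes s :: "'k::field \<Rightarrow> 'v::ab_group_add \<Rightarrow> 'v"
  assumes "v \<in> V"
  shows "eval_at s V v \<in> dual_space fun_scale (dual_space s V)"
proof -
  interpret F: vector_space "fun_scale :: 'k \<Rightarrow> ('v \<Rightarrow> 'k) \<Rightarrow> _" by (rule vector_space_fun_scale)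
  show ?thesis
    using F.subspace_add[OF dual_space_subspace] F.subspace_scale[OF dual_space_subspace]
    by (auto simp: dual_space_def[of fun_scale] linear_on_def eval_at_def fun_scale_def)
qed

text \<open>Reflexivity of a finite-dimensional space. It lets a quantifier over the bidual range
  over \<open>V\<close> instead.\<close>

lemma bidual_cases:
  assumes "fd_space s V" "\<Phi> \<in> dual_space fun_scale (dual_space s V)"
  obtains v where "v \<in> V" "\<Phi> = eval_at s V v"
proof -
  interpret S: vector_space s using assms(1) by (simp add: fd_space_def)
  have sub: "S.subspace V" using assms(1) by (rule fd_space_subspace)
  obtain B e where B: "finite B" "B \<subseteq> V" "\<And>b. b \<in> B \<Longrightarrow> e b \<in> dual_space s V"
    "\<And>v. v \<in> V \<Longrightarrow> v = (\<Sum>b\<in>B. s (e b v) b)"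
    by (rule fd_space_dual_basis[OF assms(1)]) blast
  \<comment> \<open>The coordinates of the witness are the values of \<open>\<Phi>\<close> on the
    dual basis.\<close>
  define v where "v = (\<Sum>b\<in>B. s (\<Phi> (e b)) b)"
  have vV: "v \<in> V" unfolding v_def using B(2)
    by (intro S.subspace_sum[OF sub] S.subspace_scale[OF sub]) auto
  have "\<Phi> \<xi> = \<xi> v" if \<xi>: "\<xi> \<in> dual_space s V" for \<xi>
  proof -
    have sum_ev: "(\<Sum>b\<in>B. fun_scale (\<xi> b) (e b)) x = (\<Sum>b\<in>B. \<xi> b * e b x)" for x
      using B(1) by (induction B rule: finite_induct) (auto simp: fun_scale_def)
    have "\<xi> = (\<Sum>b\<in>B. fun_scale (\<xi> b) (e b))"
    proof
      show "\<xi> x = (\<Sum>b\<in>B. fun_scale (\<xi> b) (e b)) x" for x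
        unfolding sum_ev using functional_expand[OF assms(1) \<xi> B(1,2) B(4), of x] \<xi> B(3)
        by (cases "x \<in> V") (auto simp: mult.commute dual_space_def)
    qed
    then have "\<Phi> \<xi> = \<Phi> (\<Sum>b\<in>B. fun_scale (\<xi> b) (e b))" by (rule arg_cong)
    also have "\<dots> = (\<Sum>b\<in>B. \<xi> b * \<Phi> (e b))"
      by (rule linear_on_sum[OF dual_space_linear[OF assms(2)] vector_space_fun_scale
            dual_space_subspace vector_space_mult B(1) B(3)])
    also have "\<dots> = \<xi> v"
      using functional_expand[OF assms(1) \<xi> B(1,2) v_def] by (simp add: mult.commute)
    finally show ?thesis .
  qed
  then have "\<Phi> = eval_at s V v"
    using assms(2) by (auto simp: eval_at_def dual_space_def[of fun_scale] fun_eq_iff)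
  with vV show thesis by (rule that)
qed

text \<open>Pure tensors vanish at such arguments because \<open>eval_at\<close> does, and vanishing
  at a fixed pair of arguments is inherited by linear combinations.\<close>

lemma tensor_square_support:
  fixes s :: "'k::field \<Rightarrow> 'v::ab_group_add \<Rightarrow> 'v"
  assumes "T \<in> tensor_square s V" "\<phi> \<notin> dual_space s V \<or> \<psi> \<notin> dual_space s V"
  shows "T \<phi> \<psi> = 0"
proof -
  interpret T: vector_space "tensor_scale :: 'k \<Rightarrow> (('v \<Rightarrow> 'k) \<Rightarrow> ('v \<Rightarrow> 'k) \<Rightarrow> 'k) \<Rightarrow> _"
    by (rule vector_space_tensor_scale)
  have "T.subspace {T. T \<phi> \<psi> = 0}"
    by (auto simp: T.subspace_def tensor_scale_def)
  moreover have "{pure_tensor s V v w | v w. v \<in> V \<and> w \<in> V} \<subseteq> {T. T \<phi> \<psi> = 0}"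
    using assms(2) by (auto simp: pure_tensor_def eval_at_def)
  ultimately have "tensor_square s V \<subseteq> {T. T \<phi> \<psi> = 0}"
    unfolding tensor_square_def by (rule T.span_minimal[rotated])
  with assms(1) show ?thesis by blast
qed

text \<open>Off the dual space both sides of the compatibility equation vanish, the left by
  \<open>tensor_square_support\<close> and the right by the default value of
  \<open>tensor_map\<close>, so evaluation on functionals loses nothing.\<close>

lemma coproduct_compatible_iff:
  assumes "linear_on s V tensor_scale (tensor_square s V) \<Delta>" "bilinear_on s V s V s V m"
    "module.subspace s V" "vector_space s"
  shows "coproduct_compatible s V m \<Delta> \<longleftrightarrow>
    (\<forall>x\<in>V. \<forall>y\<in>V. \<forall>\<phi>\<in>dual_space s V. \<forall>\<psi>\<in>dual_space s V.
      \<Delta> (subadj m x y) \<phi> \<psi> =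
        - (\<Delta> x \<phi> (transpose_on V (\<lambda>z. rmul m y z + m y z) \<psi>) + \<Delta> x (transpose_on V (m y) \<phi>) \<psi>)
        - (\<Delta> y \<phi> (transpose_on V (\<lambda>z. m x z + rmul m x z) \<psi>) + \<Delta> y (transpose_on V (m x) \<phi>) \<psi>))"
proof -
  interpret S: vector_space s by fact
  have "subadj m x y \<in> V" if "x \<in> V" "y \<in> V" for x y
    using assms(2) that S.subspace_add[OF assms(3)]
    by (simp add: subadj_def bilinear_on_def linear_on_def)
  then have "\<Delta> (subadj m x y) \<in> tensor_square s V" if "x \<in> V" "y \<in> V" for x y
    using assms(1) that by (simp add: linear_on_def)
  note supp = tensor_square_support[OF this]
  show ?thesis
    unfolding coproduct_compatible_def fun_eq_iff
    by (intro ball_cong refl)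
      (auto simp: tensor_map_def transpose_on_id supp)
qed

section \<open>Quadratic and symplectic algebras\<close>

lemma bilinear_on_subadj:
  assumes "bilinear_on s V s V s V m" "vector_space s" "module.subspace s V"
  shows "bilinear_on s V s V s V (subadj m)"
proof -
  interpret S: vector_space s by fact
  show ?thesis
    using assms(1) S.subspace_add[OF assms(3)]
    by (simp add: bilinear_on_def linear_on_def subadj_def S.scale_right_distrib add_ac)
qed

text \<open>Expanded, the Jacobi sum has twelve terms. They form the cyclic sum of the four-term
  expression \<open>A\<close>, which is zero by the mock-pre-Lie identity.\<close>

lemma mock_lie_subadj:
  assumes "mock_pre_lie s V m"
  shows "mock_lie s V (subadj m)"
  unfolding mock_lie_def
proof (intro conjI ballI)
  have V: "fd_space s V" and m: "bilinear_on s V s V s V m"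
    using assms by (auto simp: mock_pre_lie_def)
  interpret S: vector_space s using V by (simp add: fd_space_def)
  note sub = fd_space_subspace[OF V]
  show "fd_space s V" by fact
  show "bilinear_on s V s V s V (subadj m)"
    by (rule bilinear_on_subadj[OF m S.vector_space_axioms sub])
  show "subadj m x y = subadj m y x" for x y by (simp add: subadj_def add.commute)
  fix x y z assume xyz: "x \<in> V" "y \<in> V" "z \<in> V"
  define A where "A x y z = m (m x y) z + m x (m y z) + m (m y x) z + m y (m x z)" for x y z
  have A: "A x y z = 0" if "x \<in> V" "y \<in> V" "z \<in> V" for x y z
  proof -
    have "m (m x y) z + m x (m y z) = - m (m y x) z - m y (m x z)"
      using assms that unfolding mock_pre_lie_def by blast
    then show ?thesis by (simp add: A_def)
  qed
  have "subadj m x (subadj m y z) + subadj m y (subadj m z x) + subadj m z (subadj m x y)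
      = A x y z + A y z x + A z x y"
    using m xyz by (simp add: A_def subadj_def bilinear_on_def linear_on_def add_ac)
  then show "subadj m x (subadj m y z) + subadj m y (subadj m z x) + subadj m z (subadj m x y) = 0"
    using A xyz by simp
qed

lemma skew_nondegenerateD:
  assumes "skew_nondegenerate s V \<omega>"
  shows "x \<in> V \<Longrightarrow> y \<in> V \<Longrightarrow> z \<in> V \<Longrightarrow> \<omega> (x + y) z = \<omega> x z + \<omega> y z"
    and "x \<in> V \<Longrightarrow> y \<in> V \<Longrightarrow> z \<in> V \<Longrightarrow> \<omega> z (x + y) = \<omega> z x + \<omega> z y"
    and "x \<in> V \<Longrightarrow> y \<in> V \<Longrightarrow> \<omega> x y = - \<omega> y x"
    and "x \<in> V \<Longrightarrow> (\<And>y. y \<in> V \<Longrightarrow> \<omega> x y = 0) \<Longrightarrow> x = 0"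
    and "x \<in> V \<Longrightarrow> linear_on s V (*) UNIV (\<omega> x)"
proof -
  have \<omega>: "bilinear_on s V s V (*) UNIV \<omega>" "\<forall>x\<in>V. \<forall>y\<in>V. \<omega> x y = - \<omega> y x"
    "\<forall>x\<in>V. (\<forall>y\<in>V. \<omega> x y = 0) \<longrightarrow> x = 0"
    using assms unfolding skew_nondegenerate_def by - (elim conjE, assumption)+
  show "x \<in> V \<Longrightarrow> y \<in> V \<Longrightarrow> z \<in> V \<Longrightarrow> \<omega> (x + y) z = \<omega> x z + \<omega> y z"
    "x \<in> V \<Longrightarrow> y \<in> V \<Longrightarrow> z \<in> V \<Longrightarrow> \<omega> z (x + y) = \<omega> z x + \<omega> z y"
    "x \<in> V \<Longrightarrow> linear_on s V (*) UNIV (\<omega> x)"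
    using \<omega>(1) by (simp_all add: bilinear_on_def linear_on_def)
  show "x \<in> V \<Longrightarrow> y \<in> V \<Longrightarrow> \<omega> x y = - \<omega> y x" using \<omega>(2) by blast
  show "x \<in> V \<Longrightarrow> (\<And>y. y \<in> V \<Longrightarrow> \<omega> x y = 0) \<Longrightarrow> x = 0" using \<omega>(3) by blast
qed

text \<open>Invariance turns each of the two products in \<open>subadj m x y\<close> into a bracket
  in the second argument of the form. Skew-symmetry moves these brackets back to the first argument
  with the signs of the cyclic condition.\<close>

lemma symplectic_mock_lie_subadj:
  assumes "quadratic_mock_pre_lie s V m \<omega>"
  shows "symplectic_mock_lie s V (subadj m) \<omega>"
  unfolding symplectic_mock_lie_def
proof (intro conjI ballI)
  have m: "mock_pre_lie s V m" and \<omega>: "skew_nondegenerate s V \<omega>"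
    and inv: "\<And>x y z. x \<in> V \<Longrightarrow> y \<in> V \<Longrightarrow> z \<in> V \<Longrightarrow> \<omega> (m x y) z = \<omega> y (subadj m x z)"
    using assms by (auto simp: quadratic_mock_pre_lie_def subadj_def)
  have m_in: "m x y \<in> V" if "x \<in> V" "y \<in> V" for x y
    using m that unfolding mock_pre_lie_def bilinear_on_def linear_on_def by blast
  show b: "mock_lie s V (subadj m)" by (rule mock_lie_subadj[OF m])
  show "skew_nondegenerate s V \<omega>" by fact
  fix x y z assume xyz: "x \<in> V" "y \<in> V" "z \<in> V"
  have "\<omega> (subadj m x y) z = \<omega> (m x y) z + \<omega> (m y x) z"
    unfolding subadj_def by (intro skew_nondegenerateD(1)[OF \<omega>] m_in xyz)
  also have "\<dots> = \<omega> y (subadj m x z) + \<omega> x (subadj m y z)" by (simp add: inv xyz)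
  also have "\<dots> = - \<omega> (subadj m z x) y - \<omega> (subadj m y z) x"
  proof -
    have "subadj m z x \<in> V" "subadj m y z \<in> V"
      using b xyz by (auto simp: mock_lie_def bilinear_on_def linear_on_def)
    moreover have "subadj m x z = subadj m z x" by (simp add: subadj_def add.commute)
    ultimately show ?thesis
      using skew_nondegenerateD(3)[OF \<omega>, of y] skew_nondegenerateD(3)[OF \<omega>, of x] xyz by simp
  qed
  finally show "\<omega> (subadj m x y) z + \<omega> (subadj m y z) x + \<omega> (subadj m z x) y = 0"
    by simp
qed

text \<open>The left multiplications of \<open>m\<close> are the \<open>\<omega>\<close>-adjoints of the adjoint operators of \<open>b\<close>, so the
  Jacobi identity for \<open>b\<close>, which expresses \<open>b (b x y) z\<close> through iterated adjoint operators,
  transposes to the identity for \<open>m\<close>.\<close>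

lemma quadratic_mock_pre_lie_of_symplectic:
  assumes b: "symplectic_mock_lie s V b \<omega>" and m: "bilinear_on s V s V s V m"
    and inv: "\<And>x y z. x \<in> V \<Longrightarrow> y \<in> V \<Longrightarrow> z \<in> V \<Longrightarrow> \<omega> (m x y) z = \<omega> y (b x z)"
    and mb: "\<And>x y. x \<in> V \<Longrightarrow> y \<in> V \<Longrightarrow> m x y + m y x = b x y"
  shows "quadratic_mock_pre_lie s V m \<omega>"
proof -
  have V: "fd_space s V" and \<omega>: "skew_nondegenerate s V \<omega>"
    and Jac: "\<And>x y z. x \<in> V \<Longrightarrow> y \<in> V \<Longrightarrow> z \<in> V \<Longrightarrow> b x (b y z) + b y (b z x) + b z (b x y) = 0"
    and sym: "\<And>x y. x \<in> V \<Longrightarrow> y \<in> V \<Longrightarrow> b x y = b y x"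
    and b_in: "\<And>x y. x \<in> V \<Longrightarrow> y \<in> V \<Longrightarrow> b x y \<in> V"
    using b by (auto simp: symplectic_mock_lie_def mock_lie_def bilinear_on_def linear_on_def)
  interpret S: vector_space s using V by (simp add: fd_space_def)
  note sub = fd_space_subspace[OF V]
  note add_in = S.subspace_add[OF sub]
  have m_in: "m x y \<in> V" if "x \<in> V" "y \<in> V" for x y
    using m that by (simp add: bilinear_on_def linear_on_def)
  note \<omega>_add = skew_nondegenerateD(1,2)[OF \<omega>]
  have "m (m x y) z + m x (m y z) = - m (m y x) z - m y (m x z)"
    if xyz: "x \<in> V" "y \<in> V" "z \<in> V" for x y z
  proof -
    have "m (m x y) z + m (m y x) z = m (m x y + m y x) z"
      using m m_in xyz by (simp add: bilinear_on_def linear_on_def)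
    also have "\<dots> = m (b x y) z" using mb xyz by simp
    finally have mm: "m (m x y) z + m (m y x) z = m (b x y) z" .
    \<comment> \<open>This is the mock-pre-Lie identity brought to one side, with
      \<open>m (m x y) z\<close> and \<open>m (m y x) z\<close> merged. By nondegeneracy it suffices
      that \<open>w\<close> is orthogonal to every \<open>t\<close>.\<close>
    define w where "w = m (b x y) z + (m x (m y z) + m y (m x z))"
    have wV: "w \<in> V" using xyz by (simp add: w_def add_in m_in b_in)
    have "\<omega> w t = 0" if t: "t \<in> V" for t
    proof -
      \<comment> \<open>Each use of invariance moves a left multiplication to the second argument as
        a bracket, so composites appear in reverse order. The result is \<open>z\<close> paired with
        the Jacobi sum of \<open>x\<close>, \<open>y\<close> and \<open>t\<close>.\<close>
      have "\<omega> w t = \<omega> z (b (b x y) t) + (\<omega> z (b y (b x t)) + \<omega> z (b x (b y t)))"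
        using xyz t by (simp add: w_def \<omega>_add inv m_in b_in add_in)
      also have "\<dots> = \<omega> z (b x (b y t) + b y (b t x) + b t (b x y))"
        using xyz t sym[of x t] sym[of t "b x y"] by (simp add: \<omega>_add m_in b_in add_in)
      also have "\<dots> = \<omega> z 0" using Jac xyz t by simp
      also have "\<dots> = 0"
        by (rule linear_on_zero[OF skew_nondegenerateD(5)[OF \<omega> xyz(3)]
              S.vector_space_axioms sub vector_space_mult])
      finally show ?thesis .
    qed
    then have "w = 0" by (rule skew_nondegenerateD(4)[OF \<omega> wV])
    then have "m (m x y) z + m (m y x) z + (m x (m y z) + m y (m x z)) = 0"
      unfolding w_def mm .
    then show ?thesis by (simp add: algebra_simps eq_neg_iff_add_eq_0)
  qed
  then have "mock_pre_lie s V m" using V m unfolding mock_pre_lie_def by blast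
  then show ?thesis
    using \<omega> by (simp add: quadratic_mock_pre_lie_def inv mb)
qed

section \<open>Replacing an operation by one that agrees on the carrier\<close>

lemma bilinear_on_cong:
  assumes "bilinear_on r U s V t W f" "\<And>x y. x \<in> U \<Longrightarrow> y \<in> V \<Longrightarrow> f x y = g x y"
    "module.subspace r U" "vector_space r" "module.subspace s V" "vector_space s"
  shows "bilinear_on r U s V t W g"
proof -
  interpret R: vector_space r by fact
  interpret S: vector_space s by fact
  have "g x y = f x y" if "x \<in> U" "y \<in> V" for x y using assms(2) that by simp
  then show ?thesis
    using assms(1) R.subspace_add[OF assms(3)] R.subspace_scale[OF assms(3)]
      S.subspace_add[OF assms(5)] S.subspace_scale[OF assms(5)]
    by (simp add: bilinear_on_def linear_on_def)
qed

text \<open>Brackets that agree on the carrier need not be equal as functions. This transfers the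
  structure when only agreement is known, as for the sub-adjacent bracket of a Manin triple.\<close>

lemma symplectic_mock_lie_cong:
  assumes "symplectic_mock_lie s V b \<omega>" "\<And>x y. x \<in> V \<Longrightarrow> y \<in> V \<Longrightarrow> b x y = b' x y"
  shows "symplectic_mock_lie s V b' \<omega>"
proof -
  have V: "fd_space s V" and b: "bilinear_on s V s V s V b"
    using assms(1) by (simp_all only: symplectic_mock_lie_def mock_lie_def)
  interpret S: vector_space s using V by (simp add: fd_space_def)
  note sub = fd_space_subspace[OF V]
  have b': "bilinear_on s V s V s V b'"
    by (rule bilinear_on_cong[OF b assms(2) sub S.vector_space_axioms sub S.vector_space_axioms])
  have b_in: "b x y \<in> V" if "x \<in> V" "y \<in> V" for x y
    using b that by (simp add: bilinear_on_def linear_on_def)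
  have eq: "b' x y = b x y" if "x \<in> V" "y \<in> V" for x y
    using assms(2) that by simp
  show ?thesis
    using assms(1) b' unfolding symplectic_mock_lie_def mock_lie_def
    by (elim conjE, intro conjI) (assumption | simp add: eq b_in)+
qed

section \<open>Matched pairs\<close>

text \<open>The component in \<open>V\<close> of the Jacobi sum of three elements of the double splits into the Jacobi
  sum in \<open>V\<close>, three instances of the matched pair condition and three of the representation
  property.\<close>

lemma matched_pair_jacobi_component:
  assumes V: "vector_space s" "module.subspace s V"
    and W: "vector_space t" "module.subspace t W"
    and bg: "mock_lie s V bg" and bh: "bilinear_on t W t W t W bh"
    and \<rho>: "bilinear_on s V t W t W \<rho>" and \<mu>: "bilinear_on t W s V s V \<mu>"
    and rep: "\<forall>u\<in>W. \<forall>v\<in>W. \<forall>x\<in>V. \<mu> (bh u v) x = - \<mu> u (\<mu> v x) - \<mu> v (\<mu> u x)"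
    and compat: "\<forall>x\<in>V. \<forall>y\<in>V. \<forall>u\<in>W.
      \<mu> u (bg x y) + bg (\<mu> u x) y + bg x (\<mu> u y) + \<mu> (\<rho> x u) y + \<mu> (\<rho> y u) x = 0"
    and x: "x \<in> V" "y \<in> V" "z \<in> V" and u: "u \<in> W" "v \<in> W" "w \<in> W"
  shows "(bg x (bg y z + \<mu> v z + \<mu> w y) + \<mu> u (bg y z + \<mu> v z + \<mu> w y) + \<mu> (bh v w + \<rho> y w + \<rho> z v) x)
    + (bg y (bg z x + \<mu> w x + \<mu> u z) + \<mu> v (bg z x + \<mu> w x + \<mu> u z) + \<mu> (bh w u + \<rho> z u + \<rho> x w) y)
    + (bg z (bg x y + \<mu> u y + \<mu> v x) + \<mu> w (bg x y + \<mu> u y + \<mu> v x) + \<mu> (bh u v + \<rho> x v + \<rho> y u) z) = 0"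
    (is "?J = 0")
proof -
  interpret S: vector_space s by fact
  interpret T: vector_space t by fact
  have bg_bil: "bilinear_on s V s V s V bg"
    and sym: "\<And>x y. x \<in> V \<Longrightarrow> y \<in> V \<Longrightarrow> bg x y = bg y x"
    using bg by (simp_all add: mock_lie_def)
  have "\<forall>x\<in>V. \<forall>y\<in>V. \<forall>z\<in>V. bg x (bg y z) + bg y (bg z x) + bg z (bg x y) = 0"
    using bg unfolding mock_lie_def by (elim conjE)
  then have jac: "bg x (bg y z) + bg y (bg z x) + bg z (bg x y) = 0" using x by blast
  have closed: "\<And>x y. x \<in> V \<Longrightarrow> y \<in> V \<Longrightarrow> bg x y \<in> V" "\<And>u v. u \<in> W \<Longrightarrow> v \<in> W \<Longrightarrow> bh u v \<in> W"
    "\<And>x u. x \<in> V \<Longrightarrow> u \<in> W \<Longrightarrow> \<mu> u x \<in> V" "\<And>x u. x \<in> V \<Longrightarrow> u \<in> W \<Longrightarrow> \<rho> x u \<in> W"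
    using bg_bil bh \<rho> \<mu> by (simp_all add: bilinear_on_def linear_on_def)
  have lin: "\<And>x y z. x \<in> V \<Longrightarrow> y \<in> V \<Longrightarrow> z \<in> V \<Longrightarrow> bg x (y + z) = bg x y + bg x z"
    "\<And>u y z. u \<in> W \<Longrightarrow> y \<in> V \<Longrightarrow> z \<in> V \<Longrightarrow> \<mu> u (y + z) = \<mu> u y + \<mu> u z"
    "\<And>u v z. u \<in> W \<Longrightarrow> v \<in> W \<Longrightarrow> z \<in> V \<Longrightarrow> \<mu> (u + v) z = \<mu> u z + \<mu> v z"
    using bg_bil \<mu> by (simp_all add: bilinear_on_def linear_on_def)
  \<comment> \<open>The left side of the matched pair condition, with
    \<open>bg (\<mu> u x) y\<close> flipped to the order in which it occurs in the Jacobi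
    sum.\<close>
  define C where "C x y u = \<mu> u (bg x y) + bg y (\<mu> u x) + bg x (\<mu> u y) + \<mu> (\<rho> x u) y + \<mu> (\<rho> y u) x" for x y u
  have C: "C x y u = 0" if "x \<in> V" "y \<in> V" "u \<in> W" for x y u
    using compat[rule_format, OF that] sym[of y "\<mu> u x"] closed that by (simp add: C_def)
  \<comment> \<open>The terms are grouped by their arguments: three from \<open>V\<close> give the
    Jacobi sum, two from \<open>V\<close> and one from \<open>W\<close> give \<open>C\<close>, one
    from \<open>V\<close> and two from \<open>W\<close> give the representation identity.\<close>
  have "?J = (bg x (bg y z) + bg y (bg z x) + bg z (bg x y)) + C x y w + C y z u + C z x v
    + (\<mu> (bh v w) x + \<mu> v (\<mu> w x) + \<mu> w (\<mu> v x)) + (\<mu> (bh w u) y + \<mu> w (\<mu> u y) + \<mu> u (\<mu> w y))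
    + (\<mu> (bh u v) z + \<mu> u (\<mu> v z) + \<mu> v (\<mu> u z))"
    using x u S.subspace_add[OF V(2)] T.subspace_add[OF W(2)]
    by (simp add: closed lin C_def add_ac)
  also have "\<dots> = 0" using jac C rep x u by simp
  finally show ?thesis .
qed

section \<open>Two products in duality\<close>

locale dual_mock_pre_lie =
  fixes s :: "'k::field \<Rightarrow> 'v::ab_group_add \<Rightarrow> 'v"
    and V :: "'v set"
    and mg :: "'v \<Rightarrow> 'v \<Rightarrow> 'v"
    and md :: "('v \<Rightarrow> 'k) \<Rightarrow> ('v \<Rightarrow> 'k) \<Rightarrow> ('v \<Rightarrow> 'k)"
  assumes g: "mock_pre_lie s V mg"
    and g_dual: "mock_pre_lie fun_scale (dual_space s V) md"
begin

abbreviation "D \<equiv> dual_space s V"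
abbreviation L :: "'v \<Rightarrow> ('v \<Rightarrow> 'k) \<Rightarrow> 'v \<Rightarrow> 'k" where "L \<equiv> Lstar V mg"
abbreviation R :: "'v \<Rightarrow> ('v \<Rightarrow> 'k) \<Rightarrow> 'v \<Rightarrow> 'k" where "R \<equiv> Rstar V mg"
abbreviation "Ld \<equiv> dual_Lstar s V md"
abbreviation "Rd \<equiv> dual_Rstar s V md"

lemma fd_V: "fd_space s V" and bilinear_mg: "bilinear_on s V s V s V mg"
  and fd_D: "fd_space fun_scale D" and bilinear_md: "bilinear_on fun_scale D fun_scale D fun_scale D md"
  using g g_dual by (simp_all only: mock_pre_lie_def)

sublocale S: vector_space s
  using fd_V by (simp add: fd_space_def)

sublocale F: vector_space "fun_scale :: 'k \<Rightarrow> ('v \<Rightarrow> 'k) \<Rightarrow> _"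
  by (rule vector_space_fun_scale)

lemmas subspace_V = fd_space_subspace[OF fd_V]
lemmas subspace_D = fd_space_subspace[OF fd_D]

lemmas V_closed [simp] =
  S.subspace_0[OF subspace_V] S.subspace_add[OF subspace_V] S.subspace_diff[OF subspace_V]
  S.subspace_neg[OF subspace_V] S.subspace_scale[OF subspace_V]

lemmas D_closed [simp] =
  F.subspace_0[OF subspace_D] F.subspace_add[OF subspace_D] F.subspace_diff[OF subspace_D]
  F.subspace_neg[OF subspace_D] F.subspace_scale[OF subspace_D]

lemma linear_mg: "x \<in> V \<Longrightarrow> linear_on s V s V (mg x)" "y \<in> V \<Longrightarrow> linear_on s V s V (\<lambda>x. mg x y)"
  and linear_md: "\<xi> \<in> D \<Longrightarrow> linear_on fun_scale D fun_scale D (md \<xi>)"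
    "\<eta> \<in> D \<Longrightarrow> linear_on fun_scale D fun_scale D (\<lambda>\<xi>. md \<xi> \<eta>)"
  using bilinear_mg bilinear_md by (simp_all add: bilinear_on_def)

lemma mg_closed [simp]: "x \<in> V \<Longrightarrow> y \<in> V \<Longrightarrow> mg x y \<in> V"
  and md_closed [simp]: "\<xi> \<in> D \<Longrightarrow> \<eta> \<in> D \<Longrightarrow> md \<xi> \<eta> \<in> D"
  using linear_mg linear_md by (simp_all add: linear_on_def)

lemma mg_linear [simp]:
  assumes "x \<in> V" "y \<in> V" "z \<in> V"
  shows "mg x (y + z) = mg x y + mg x z" "mg (y + z) x = mg y x + mg z x"
    "mg x (y - z) = mg x y - mg x z" "mg (y - z) x = mg y x - mg z x"
    "mg x (- y) = - mg x y" "mg (- y) x = - mg y x"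
    "mg x (s c y) = s c (mg x y)" "mg (s c y) x = s c (mg y x)"
  using assms linear_mg
    linear_on_diff[OF linear_mg(1) S.vector_space_axioms subspace_V S.vector_space_axioms]
    linear_on_diff[OF linear_mg(2) S.vector_space_axioms subspace_V S.vector_space_axioms]
    linear_on_uminus[OF linear_mg(1) S.vector_space_axioms subspace_V S.vector_space_axioms]
    linear_on_uminus[OF linear_mg(2) S.vector_space_axioms subspace_V S.vector_space_axioms]
  by (simp_all add: linear_on_def)

lemma md_linear [simp]:
  assumes "\<xi> \<in> D" "\<eta> \<in> D" "\<zeta> \<in> D"
  shows "md \<xi> (\<eta> + \<zeta>) = md \<xi> \<eta> + md \<xi> \<zeta>" "md (\<eta> + \<zeta>) \<xi> = md \<eta> \<xi> + md \<zeta> \<xi>"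
    "md \<xi> (\<eta> - \<zeta>) = md \<xi> \<eta> - md \<xi> \<zeta>" "md (\<eta> - \<zeta>) \<xi> = md \<eta> \<xi> - md \<zeta> \<xi>"
    "md \<xi> (- \<eta>) = - md \<xi> \<eta>" "md (- \<eta>) \<xi> = - md \<eta> \<xi>"
    "md \<xi> (fun_scale c \<eta>) = fun_scale c (md \<xi> \<eta>)" "md (fun_scale c \<eta>) \<xi> = fun_scale c (md \<eta> \<xi>)"
  using assms linear_md
    linear_on_diff[OF linear_md(1) F.vector_space_axioms subspace_D F.vector_space_axioms]
    linear_on_diff[OF linear_md(2) F.vector_space_axioms subspace_D F.vector_space_axioms]
    linear_on_uminus[OF linear_md(1) F.vector_space_axioms subspace_D F.vector_space_axioms]
    linear_on_uminus[OF linear_md(2) F.vector_space_axioms subspace_D F.vector_space_axioms]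
  by (simp_all add: linear_on_def)

lemma D_linear [simp]:
  assumes "\<xi> \<in> D" "x \<in> V" "y \<in> V"
  shows "\<xi> (x + y) = \<xi> x + \<xi> y" "\<xi> (x - y) = \<xi> x - \<xi> y" "\<xi> (- x) = - \<xi> x"
    "\<xi> (s c x) = c * \<xi> x"
  using assms dual_space_linear[OF assms(1)]
    linear_on_diff[OF dual_space_linear S.vector_space_axioms subspace_V vector_space_mult]
    linear_on_uminus[OF dual_space_linear S.vector_space_axioms subspace_V vector_space_mult]
  by (simp_all add: linear_on_def)

lemma products_zero [simp]:
  "x \<in> V \<Longrightarrow> mg x 0 = 0" "x \<in> V \<Longrightarrow> mg 0 x = 0"
  "\<xi> \<in> D \<Longrightarrow> md \<xi> 0 = 0" "\<xi> \<in> D \<Longrightarrow> md 0 \<xi> = 0" "\<xi> \<in> D \<Longrightarrow> \<xi> 0 = 0"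
  using mg_linear(3,4)[of x 0 0] md_linear(3,4)[of \<xi> 0 0] D_linear(2)[of \<xi> 0 0]
  by (simp_all del: mg_linear md_linear D_linear)

lemma fun_scale_apply [simp]: "fun_scale c \<xi> x = c * \<xi> x"
  by (simp add: fun_scale_def)

section \<open>Dual maps and their pairings\<close>

lemma Lstar_closed [simp]: "x \<in> V \<Longrightarrow> \<xi> \<in> D \<Longrightarrow> L x \<xi> \<in> D"
  and Rstar_closed [simp]: "x \<in> V \<Longrightarrow> \<xi> \<in> D \<Longrightarrow> R x \<xi> \<in> D"
  unfolding Lstar_def Rstar_def neg_dual_eq_transpose
  using transpose_on_in_dual_space[OF fd_V] linear_mg by (auto simp: rmul_def[abs_def])

lemma Lstar_apply [simp]: "x \<in> V \<Longrightarrow> y \<in> V \<Longrightarrow> L x \<xi> y = - \<xi> (mg x y)"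
  and Rstar_apply [simp]: "x \<in> V \<Longrightarrow> y \<in> V \<Longrightarrow> R x \<xi> y = - \<xi> (mg y x)"
  by (simp_all add: Lstar_def Rstar_def neg_dual_def rmul_def)

lemma dual_Lstar_closed [simp]: "\<xi> \<in> D \<Longrightarrow> x \<in> V \<Longrightarrow> Ld \<xi> x \<in> V"
  and dual_Rstar_closed [simp]: "\<xi> \<in> D \<Longrightarrow> x \<in> V \<Longrightarrow> Rd \<xi> x \<in> V"
  and dual_Lstar_pairing [simp]: "\<xi> \<in> D \<Longrightarrow> x \<in> V \<Longrightarrow> \<eta> \<in> D \<Longrightarrow> \<eta> (Ld \<xi> x) = - md \<xi> \<eta> x"
  and dual_Rstar_pairing [simp]: "\<xi> \<in> D \<Longrightarrow> x \<in> V \<Longrightarrow> \<eta> \<in> D \<Longrightarrow> \<eta> (Rd \<xi> x) = - md \<eta> \<xi> x"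
  unfolding dual_Lstar_def dual_Rstar_def rmul_def[abs_def]
  using neg_predual_pairing[OF fd_V linear_md(1)] neg_predual_pairing[OF fd_V linear_md(2)]
  by blast+

text \<open>Together with the pairings above, these rules reduce every scalar built from the two products
  and their duals to evaluations of \<open>md\<close>.\<close>

lemma pairing_mg_dual [simp]:
  assumes "\<xi> \<in> D" "\<eta> \<in> D" "x \<in> V" "y \<in> V"
  shows "\<eta> (mg (Ld \<xi> x) y) = md \<xi> (R y \<eta>) x" "\<eta> (mg y (Ld \<xi> x)) = md \<xi> (L y \<eta>) x"
    "\<eta> (mg (Rd \<xi> x) y) = md (R y \<eta>) \<xi> x" "\<eta> (mg y (Rd \<xi> x)) = md (L y \<eta>) \<xi> x"
proof -
  \<comment> \<open>Multiplication by \<open>y\<close> is shifted onto the functional, so that the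
    vector left over is a bare \<open>Ld \<xi> x\<close> or \<open>Rd \<xi> x\<close>. Its pairing
    rule brings a second minus sign, which cancels the first.\<close>
  have "\<eta> (mg z y) = - R y \<eta> z" "\<eta> (mg y z) = - L y \<eta> z" if "z \<in> V" for z
    using assms that by simp_all
  then show "\<eta> (mg (Ld \<xi> x) y) = md \<xi> (R y \<eta>) x" "\<eta> (mg y (Ld \<xi> x)) = md \<xi> (L y \<eta>) x"
    "\<eta> (mg (Rd \<xi> x) y) = md (R y \<eta>) \<xi> x" "\<eta> (mg y (Rd \<xi> x)) = md (L y \<eta>) \<xi> x"
    using assms by (simp_all del: Lstar_apply Rstar_apply)
qed

text \<open>With \<open>D_eq_iff\<close>, this replaces equations between vectors or functionals by
  scalar equations that the pairing rules evaluate.\<close>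

lemma V_eq_iff: "x \<in> V \<Longrightarrow> y \<in> V \<Longrightarrow> x = y \<longleftrightarrow> (\<forall>\<eta>\<in>D. \<eta> x = \<eta> y)"
  using dual_space_separates[OF fd_V] by blast

lemma D_eq_iff: "\<xi> \<in> D \<Longrightarrow> \<eta> \<in> D \<Longrightarrow> \<xi> = \<eta> \<longleftrightarrow> (\<forall>x\<in>V. \<xi> x = \<eta> x)"
  using dual_space_eqI by blast

lemma bilinear_Lstar: "bilinear_on s V fun_scale D fun_scale D (\<lambda>x \<xi>. - L x \<xi>)"
  and bilinear_LRstar: "bilinear_on s V fun_scale D fun_scale D (\<lambda>x \<xi>. - L x \<xi> - R x \<xi>)"
  and bilinear_Rstar: "bilinear_on s V fun_scale D fun_scale D R"
  by (simp_all add: bilinear_on_def linear_on_def D_eq_iff algebra_simps)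

lemma bilinear_dual_Lstar: "bilinear_on fun_scale D s V s V (\<lambda>\<xi> x. - Ld \<xi> x)"
  and bilinear_dual_LRstar: "bilinear_on fun_scale D s V s V (\<lambda>\<xi> x. - Ld \<xi> x - Rd \<xi> x)"
  and bilinear_dual_Rstar: "bilinear_on fun_scale D s V s V Rd"
  by (simp_all add: bilinear_on_def linear_on_def V_eq_iff algebra_simps)

section \<open>The defining identities and the dual representations\<close>

lemma mg_identity:
  assumes "x \<in> V" "y \<in> V" "z \<in> V"
  shows "mg (mg x y) z + mg (mg y x) z + mg x (mg y z) + mg y (mg x z) = 0"
proof -
  have "mg (mg x y) z + mg x (mg y z) = - mg (mg y x) z - mg y (mg x z)"
    using g assms unfolding mock_pre_lie_def by blast
  then show ?thesis by (simp add: eq_neg_iff_add_eq_0 algebra_simps)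
qed

lemma md_identity:
  assumes "\<xi> \<in> D" "\<eta> \<in> D" "\<zeta> \<in> D"
  shows "md (md \<xi> \<eta>) \<zeta> + md (md \<eta> \<xi>) \<zeta> + md \<xi> (md \<eta> \<zeta>) + md \<eta> (md \<xi> \<zeta>) = 0"
proof -
  have "md (md \<xi> \<eta>) \<zeta> + md \<xi> (md \<eta> \<zeta>) = - md (md \<eta> \<xi>) \<zeta> - md \<eta> (md \<xi> \<zeta>)"
    using g_dual assms unfolding mock_pre_lie_def by blast
  then show ?thesis by (simp add: eq_neg_iff_add_eq_0 algebra_simps)
qed

text \<open>The identity is solved for one term to serve as a rewrite rule. Its uses fix two of the
  arguments, since the right-hand side contains the same pattern with the first two
  exchanged.\<close>

lemma pairing_mg_identity:
  assumes "x \<in> V" "y \<in> V" "z \<in> V" "\<xi> \<in> D"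
  shows "\<xi> (mg (mg x y) z) = - \<xi> (mg (mg y x) z) - \<xi> (mg x (mg y z)) - \<xi> (mg y (mg x z))"
proof -
  have "\<xi> (mg (mg x y) z + mg (mg y x) z + mg x (mg y z) + mg y (mg x z)) = \<xi> 0"
    using mg_identity assms by simp
  then have "\<xi> (mg (mg x y) z) + (\<xi> (mg (mg y x) z) + \<xi> (mg x (mg y z)) + \<xi> (mg y (mg x z))) = 0"
    using assms by (simp add: add.assoc)
  then show ?thesis unfolding eq_neg_iff_add_eq_0[symmetric] by simp
qed

lemma pairing_md_identity:
  assumes "\<xi> \<in> D" "\<eta> \<in> D" "\<zeta> \<in> D" "x \<in> V"
  shows "md (md \<xi> \<eta>) \<zeta> x = - md (md \<eta> \<xi>) \<zeta> x - md \<xi> (md \<eta> \<zeta>) x - md \<eta> (md \<xi> \<zeta>) x"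
proof -
  have "(md (md \<xi> \<eta>) \<zeta> + md (md \<eta> \<xi>) \<zeta> + md \<xi> (md \<eta> \<zeta>) + md \<eta> (md \<xi> \<zeta>)) x = 0"
    using md_identity assms by simp
  then have "md (md \<xi> \<eta>) \<zeta> x + (md (md \<eta> \<xi>) \<zeta> x + md \<xi> (md \<eta> \<zeta>) x + md \<eta> (md \<xi> \<zeta>) x) = 0"
    by (simp add: add.assoc)
  then show ?thesis unfolding eq_neg_iff_add_eq_0[symmetric] by simp
qed

lemma subadj_closed [simp]: "x \<in> V \<Longrightarrow> y \<in> V \<Longrightarrow> subadj mg x y \<in> V"
  "\<xi> \<in> D \<Longrightarrow> \<eta> \<in> D \<Longrightarrow> subadj md \<xi> \<eta> \<in> D"
  by (simp_all add: subadj_def)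

text \<open>Paired with a vector, the representation identity is one instance of the mock-pre-Lie
  identity: dualizing reverses composites, but the identity is symmetric in \<open>x\<close> and
  \<open>y\<close>.\<close>

lemma mock_lie_rep_Lstar: "mock_lie_rep s V (subadj mg) fun_scale D (\<lambda>x \<xi>. - L x \<xi>)"
  unfolding mock_lie_rep_def
proof (intro conjI ballI mock_lie_subadj g fd_D bilinear_Lstar)
  fix x y \<xi> assume *: "x \<in> V" "y \<in> V" "\<xi> \<in> D"
  show "- L (subadj mg x y) \<xi> = - (- L x (- L y \<xi>)) - - L y (- L x \<xi>)"
    using * by (simp add: D_eq_iff) (simp add: subadj_def pairing_mg_identity[of x y])
qed

text \<open>The map -L* - R* is dual to the adjoint action of the sub-adjacent bracket, so its
  representation identity is the Jacobi identity paired with a functional.\<close>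

lemma mock_pre_lie_rep_LRstar: "mock_pre_lie_rep s V mg fun_scale D (\<lambda>x \<xi>. - L x \<xi> - R x \<xi>) R"
  unfolding mock_pre_lie_rep_def mock_lie_rep_def
proof (intro conjI ballI mock_lie_subadj g fd_D bilinear_LRstar bilinear_Rstar)
  fix x y \<xi> assume *: "x \<in> V" "y \<in> V" "\<xi> \<in> D"
  show "- L (subadj mg x y) \<xi> - R (subadj mg x y) \<xi> =
      - (- L x (- L y \<xi> - R y \<xi>) - R x (- L y \<xi> - R y \<xi>))
      - (- L y (- L x \<xi> - R x \<xi>) - R y (- L x \<xi> - R x \<xi>))"
    using * by (simp add: D_eq_iff)
      (simp add: subadj_def pairing_mg_identity[of x y] pairing_mg_identity[of _ x y]
        pairing_mg_identity[of _ y x])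
  \<comment> \<open>The terms with two right multiplications cancel, and at a vector
    \<open>z\<close> what remains is the mock-pre-Lie identity for \<open>z\<close>,
    \<open>x\<close>, \<open>y\<close>.\<close>
  show "- L x (R y \<xi>) - R x (R y \<xi>) + R y (- L x \<xi> - R x \<xi>) = - R (mg x y) \<xi> - R y (R x \<xi>)"
    using * by (simp add: D_eq_iff) (simp add: pairing_mg_identity[of _ x y])
qed

lemma mock_lie_rep_dual_Lstar: "mock_lie_rep fun_scale D (subadj md) s V (\<lambda>\<xi> x. - Ld \<xi> x)"
  unfolding mock_lie_rep_def
proof (intro conjI ballI mock_lie_subadj g_dual fd_V bilinear_dual_Lstar)
  fix \<xi> \<eta> x assume *: "\<xi> \<in> D" "\<eta> \<in> D" "x \<in> V"
  show "- Ld (subadj md \<xi> \<eta>) x = - (- Ld \<xi> (- Ld \<eta> x)) - - Ld \<eta> (- Ld \<xi> x)"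
    using * by (simp add: V_eq_iff) (simp add: subadj_def pairing_md_identity[of \<xi> \<eta>])
qed

text \<open>Mirror image of \<open>mock_pre_lie_rep_LRstar\<close>, with equations in
  \<open>V\<close> tested by functionals.\<close>

lemma mock_pre_lie_rep_dual_LRstar:
  "mock_pre_lie_rep fun_scale D md s V (\<lambda>\<xi> x. - Ld \<xi> x - Rd \<xi> x) Rd"
  unfolding mock_pre_lie_rep_def mock_lie_rep_def
proof (intro conjI ballI mock_lie_subadj g_dual fd_V bilinear_dual_LRstar bilinear_dual_Rstar)
  fix \<xi> \<eta> x assume *: "\<xi> \<in> D" "\<eta> \<in> D" "x \<in> V"
  show "- Ld (subadj md \<xi> \<eta>) x - Rd (subadj md \<xi> \<eta>) x =
      - (- Ld \<xi> (- Ld \<eta> x - Rd \<eta> x) - Rd \<xi> (- Ld \<eta> x - Rd \<eta> x))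
      - (- Ld \<eta> (- Ld \<xi> x - Rd \<xi> x) - Rd \<eta> (- Ld \<xi> x - Rd \<xi> x))"
    using * by (simp add: V_eq_iff)
      (simp add: subadj_def pairing_md_identity[of \<xi> \<eta>] pairing_md_identity[of _ \<xi> \<eta>]
        pairing_md_identity[of _ \<eta> \<xi>])
  show "- Ld \<xi> (Rd \<eta> x) - Rd \<xi> (Rd \<eta> x) + Rd \<eta> (- Ld \<xi> x - Rd \<xi> x)
      = - Rd (md \<xi> \<eta>) x - Rd \<eta> (Rd \<xi> x)"
    using * by (simp add: V_eq_iff) (simp add: pairing_md_identity[of _ \<xi> \<eta>])
qed

section \<open>The bialgebra condition in scalar form\<close>

definition compat_g :: "'v \<Rightarrow> 'v \<Rightarrow> ('v \<Rightarrow> 'k) \<Rightarrow> ('v \<Rightarrow> 'k) \<Rightarrow> bool" where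
  "compat_g x y \<xi> \<eta> \<longleftrightarrow>
     md \<xi> \<eta> (subadj mg x y) = md \<xi> (L y \<eta> + R y \<eta>) x + md (L y \<xi>) \<eta> x
       + md \<xi> (L x \<eta> + R x \<eta>) y + md (L x \<xi>) \<eta> y"

text \<open>Mirror image of \<open>compat_g\<close>. In both, the minus signs of the coproduct
  condition are absorbed because the transpose of a multiplication is minus its dual map.\<close>

definition compat_dual :: "('v \<Rightarrow> 'k) \<Rightarrow> ('v \<Rightarrow> 'k) \<Rightarrow> 'v \<Rightarrow> 'v \<Rightarrow> bool" where
  "compat_dual \<xi> \<eta> x y \<longleftrightarrow>
     subadj md \<xi> \<eta> (mg x y) = \<xi> (mg x (Ld \<eta> y + Rd \<eta> y)) + \<xi> (mg (Ld \<eta> x) y)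
       + \<eta> (mg x (Ld \<xi> y + Rd \<xi> y)) + \<eta> (mg (Ld \<xi> x) y)"

definition compatible :: bool where
  "compatible \<longleftrightarrow> (\<forall>x\<in>V. \<forall>y\<in>V. \<forall>\<xi>\<in>D. \<forall>\<eta>\<in>D. compat_g x y \<xi> \<eta>) \<and>
     (\<forall>\<xi>\<in>D. \<forall>\<eta>\<in>D. \<forall>x\<in>V. \<forall>y\<in>V. compat_dual \<xi> \<eta> x y)"

lemma coproduct_compatible_g_iff:
  assumes "dual_of_dual_product s V md \<alpha>"
  shows "coproduct_compatible s V mg \<alpha> \<longleftrightarrow> (\<forall>x\<in>V. \<forall>y\<in>V. \<forall>\<xi>\<in>D. \<forall>\<eta>\<in>D. compat_g x y \<xi> \<eta>)"
proof -
  have lin: "linear_on s V tensor_scale (tensor_square s V) \<alpha>"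
    using assms by (simp add: dual_of_dual_product_def)
  have \<alpha>: "\<alpha> x \<xi> \<eta> = md \<xi> \<eta> x" if "x \<in> V" "\<xi> \<in> D" "\<eta> \<in> D" for x \<xi> \<eta>
    using assms that by (simp add: dual_of_dual_product_def)
  have tL: "transpose_on V (mg x) \<xi> = - L x \<xi>" for x \<xi>
    by (simp add: Lstar_def neg_dual_eq_transpose)
  have tLR: "transpose_on V (\<lambda>z. mg x z + rmul mg x z) \<xi> = - L x \<xi> - R x \<xi>"
    "transpose_on V (\<lambda>z. rmul mg x z + mg x z) \<xi> = - L x \<xi> - R x \<xi>"
    if "x \<in> V" "\<xi> \<in> D" for x \<xi>
    using that by (auto simp: fun_eq_iff transpose_on_def Lstar_def Rstar_def neg_dual_def rmul_def)
  show ?thesis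
    unfolding coproduct_compatible_iff[OF lin bilinear_mg subspace_V S.vector_space_axioms] compat_g_def
    by (intro ball_cong refl) (simp add: tL tLR \<alpha> algebra_simps)
qed

lemma coproduct_compatible_dual_iff:
  assumes "dual_of_product s V mg \<beta>"
  shows "coproduct_compatible fun_scale D md \<beta> \<longleftrightarrow> (\<forall>\<xi>\<in>D. \<forall>\<eta>\<in>D. \<forall>x\<in>V. \<forall>y\<in>V. compat_dual \<xi> \<eta> x y)"
proof -
  have lin: "linear_on fun_scale D tensor_scale (tensor_square fun_scale D) \<beta>"
    using assms by (simp add: dual_of_product_def)
  have \<beta>: "\<beta> \<xi> (eval_at s V x) (eval_at s V y) = \<xi> (mg x y)" if "x \<in> V" "y \<in> V" "\<xi> \<in> D" for x y \<xi>
    using assms that by (simp add: dual_of_product_def)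
  \<comment> \<open>Under the embedding into the bidual, transposes of multiplications in the dual
    space become minus the dual maps on \<open>V\<close>.\<close>
  have tL: "transpose_on D (md \<xi>) (eval_at s V x) = eval_at s V (- Ld \<xi> x)"
    and tLR: "transpose_on D (\<lambda>z. md \<xi> z + rmul md \<xi> z) (eval_at s V x) = eval_at s V (- Ld \<xi> x - Rd \<xi> x)"
    "transpose_on D (\<lambda>z. rmul md \<xi> z + md \<xi> z) (eval_at s V x) = eval_at s V (- Ld \<xi> x - Rd \<xi> x)"
    if "x \<in> V" "\<xi> \<in> D" for x \<xi>
    using that by (auto simp: fun_eq_iff transpose_on_def eval_at_def rmul_def)
  \<comment> \<open>By reflexivity, testing on the bidual amounts to testing on vectors of
    \<open>V\<close>.\<close>
  have bidual: "(\<forall>\<Phi>\<in>dual_space fun_scale D. P \<Phi>) \<longleftrightarrow> (\<forall>x\<in>V. P (eval_at s V x))" for P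
    using bidual_cases[OF fd_V] eval_at_in_bidual by metis
  show ?thesis
    unfolding coproduct_compatible_iff[OF lin bilinear_md subspace_D F.vector_space_axioms]
      compat_dual_def bidual
    by (intro ball_cong refl) (simp add: tL tLR \<beta> algebra_simps)
qed

lemma bialgebra_iff:
  assumes "dual_of_dual_product s V md \<alpha>" "dual_of_product s V mg \<beta>"
  shows "mock_pre_lie_bialgebra s V mg md \<alpha> \<beta> \<longleftrightarrow> compatible"
  using assms g g_dual coproduct_compatible_g_iff coproduct_compatible_dual_iff
  by (simp add: mock_pre_lie_bialgebra_def compatible_def)

section \<open>Matched pair conditions as scalar identities\<close>

lemma lie_pair_condition_dual:
  assumes "x \<in> V" "\<xi> \<in> D" "\<eta> \<in> D"
  shows "- L x (subadj md \<xi> \<eta>) + subadj md (- L x \<xi>) \<eta> + subadj md \<xi> (- L x \<eta>)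
        + - L (- Ld \<xi> x) \<eta> + - L (- Ld \<eta> x) \<xi> = 0 \<longleftrightarrow> (\<forall>y\<in>V. compat_dual \<xi> \<eta> x y)"
  using assms by (simp add: D_eq_iff) (simp add: compat_dual_def subadj_def algebra_simps)

text \<open>Pairing with \<open>\<eta>\<close> moves every dual map to the other side and leaves
  exactly the terms of \<open>compat_g\<close>.\<close>

lemma lie_pair_condition_g:
  assumes "x \<in> V" "y \<in> V" "\<xi> \<in> D"
  shows "- Ld \<xi> (subadj mg x y) + subadj mg (- Ld \<xi> x) y + subadj mg x (- Ld \<xi> y)
        + - Ld (- L x \<xi>) y + - Ld (- L y \<xi>) x = 0 \<longleftrightarrow> (\<forall>\<eta>\<in>D. compat_g x y \<xi> \<eta>)"
  using assms by (simp add: V_eq_iff) (simp add: compat_g_def subadj_def algebra_simps)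

text \<open>The algebra and representation clauses hold for any two products in duality, which
  leaves the two mixed conditions.\<close>

lemma lie_pair_iff:
  "mock_lie_matched_pair s V (subadj mg) fun_scale D (subadj md) (\<lambda>x \<xi>. - L x \<xi>) (\<lambda>\<xi> x. - Ld \<xi> x)
    \<longleftrightarrow> compatible"
  unfolding mock_lie_matched_pair_def compatible_def
  using mock_lie_subadj[OF g] mock_lie_subadj[OF g_dual] mock_lie_rep_Lstar mock_lie_rep_dual_Lstar
    lie_pair_condition_dual lie_pair_condition_g
  by (smt (verit, best))

text \<open>Of the four mixed conditions, the first and fourth amount to \<open>compat_g\<close>,
  the second and third to \<open>compat_dual\<close>.\<close>

lemma pre_lie_pair_iff:
  "mock_pre_lie_matched_pair s V mg fun_scale D md (\<lambda>x \<xi>. - L x \<xi> - R x \<xi>) R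
     (\<lambda>\<xi> x. - Ld \<xi> x - Rd \<xi> x) Rd \<longleftrightarrow> compatible"
proof -
  \<comment> \<open>Pairing \<open>Rd \<xi>\<close> with \<open>\<eta>\<close> puts
    \<open>\<eta>\<close> into the first factor, hence the exchanged functionals.\<close>
  have 1: "0 = Rd \<xi> (subadj mg x y) + Rd (- L y \<xi> - R y \<xi>) x + Rd (- L x \<xi> - R x \<xi>) y
        + mg x (Rd \<xi> y) + mg y (Rd \<xi> x) \<longleftrightarrow> (\<forall>\<eta>\<in>D. compat_g x y \<eta> \<xi>)"
    if "x \<in> V" "y \<in> V" "\<xi> \<in> D" for x y \<xi>
    using that by (simp add: V_eq_iff) (simp add: compat_g_def subadj_def algebra_simps eq_commute)
  have 2: "0 = R x (subadj md \<xi> \<eta>) + R (- Ld \<eta> x - Rd \<eta> x) \<xi> + R (- Ld \<xi> x - Rd \<xi> x) \<eta>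
        + md \<xi> (R x \<eta>) + md \<eta> (R x \<xi>) \<longleftrightarrow> (\<forall>y\<in>V. compat_dual \<xi> \<eta> y x)"
    if "x \<in> V" "\<xi> \<in> D" "\<eta> \<in> D" for x \<xi> \<eta>
    using that by (simp add: D_eq_iff) (simp add: compat_dual_def subadj_def algebra_simps eq_commute)
  \<comment> \<open>The two actions of each algebra add up to minus the dual of left multiplication.
    The left side pairs to the bracket of \<open>\<xi>\<close> and \<open>\<eta>\<close> at
    \<open>mg x y\<close>, so an equation in \<open>V\<close> yields the condition on the dual
    side.\<close>
  have 3: "- (- Ld \<xi> (mg x y) - Rd \<xi> (mg x y)) =
        - Ld (- L x \<xi> - R x \<xi> + R x \<xi>) y - Rd (- L x \<xi> - R x \<xi> + R x \<xi>) y
        + mg (- Ld \<xi> x - Rd \<xi> x + Rd \<xi> x) y + Rd (R y \<xi>) x + mg x (- Ld \<xi> y - Rd \<xi> y)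
      \<longleftrightarrow> (\<forall>\<eta>\<in>D. compat_dual \<xi> \<eta> x y)"
    if "x \<in> V" "y \<in> V" "\<xi> \<in> D" for x y \<xi>
    using that by (simp add: V_eq_iff) (simp add: compat_dual_def subadj_def algebra_simps eq_commute)
  have 4: "- (- L x (md \<xi> \<eta>) - R x (md \<xi> \<eta>)) =
        - L (- Ld \<xi> x - Rd \<xi> x + Rd \<xi> x) \<eta> - R (- Ld \<xi> x - Rd \<xi> x + Rd \<xi> x) \<eta>
        + md (- L x \<xi> - R x \<xi> + R x \<xi>) \<eta> + R (Rd \<eta> x) \<xi> + md \<xi> (- L x \<eta> - R x \<eta>)
      \<longleftrightarrow> (\<forall>y\<in>V. compat_g x y \<xi> \<eta>)"
    if "x \<in> V" "\<xi> \<in> D" "\<eta> \<in> D" for x \<xi> \<eta>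
    using that by (simp add: D_eq_iff) (simp add: compat_g_def subadj_def algebra_simps eq_commute)
  show ?thesis
    unfolding mock_pre_lie_matched_pair_def compatible_def
    using g g_dual mock_pre_lie_rep_LRstar mock_pre_lie_rep_dual_LRstar 1 2 3 4
    by (smt (verit, best))
qed

section \<open>The double\<close>

lemma double_scale_apply [simp]: "double_scale s c (x, \<xi>) = (s c x, fun_scale c \<xi>)"
proof -
  interpret P: vector_space_prod s "fun_scale :: 'k \<Rightarrow> ('v \<Rightarrow> 'k) \<Rightarrow> _" by unfold_locales
  show ?thesis by (simp add: double_scale_def P.scale_prod)
qed

sublocale double: vector_space "double_scale s"
  by unfold_locales (auto simp: S.scale_right_distrib S.scale_left_distrib F.scale_right_distrib F.scale_left_distrib)

lemma fd_double: "fd_space (double_scale s) (double_space s V)"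
proof -
  interpret P: vector_space_prod s "fun_scale :: 'k \<Rightarrow> ('v \<Rightarrow> 'k) \<Rightarrow> _" by unfold_locales
  obtain B where B: "finite B" "V = S.span B" using fd_V by (auto simp: fd_space_def)
  obtain C where C: "finite C" "D = F.span C" using fd_D by (auto simp: fd_space_def)
  have "double.span (B \<times> {0} \<union> {0} \<times> C) = {x + y | x y. x \<in> V \<times> {0} \<and> y \<in> {0} \<times> D}"
    using P.span_Times_sing1[of C] P.span_Times_sing2[of B]
    by (simp add: double_scale_def P.p.span_Un B(2)[symmetric] C(2)[symmetric])
  also have "\<dots> = double_space s V" by (force simp: double_space_def)
  finally have "double_space s V = double.span (B \<times> {0} \<union> {0} \<times> C)" ..
  moreover have "finite (B \<times> {0} \<union> {0} \<times> C)" using B(1) C(1) by simp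
  ultimately show ?thesis
    unfolding fd_space_def using double.vector_space_axioms by blast
qed

lemma mem_double_space [simp]: "(x, \<xi>) \<in> double_space s V \<longleftrightarrow> x \<in> V \<and> \<xi> \<in> D"
  by (simp add: double_space_def)

lemma ball_double_space: "(\<forall>p\<in>double_space s V. P p) \<longleftrightarrow> (\<forall>x\<in>V. \<forall>\<xi>\<in>D. P (x, \<xi>))"
  by (auto simp: double_space_def)

lemma double_form_apply [simp]: "double_form (x, \<xi>) (y, \<eta>) = \<xi> y - \<eta> x"
  by (simp add: double_form_def)

lemma double_bracket_apply:
  "double_bracket s V mg md (x, \<xi>) (y, \<eta>) =
    (subadj mg x y - Ld \<xi> y - Ld \<eta> x, subadj md \<xi> \<eta> - L x \<eta> - L y \<xi>)"
  by (simp add: double_bracket_def)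

lemma double_form_skew_nondegenerate:
  "skew_nondegenerate (double_scale s) (double_space s V) double_form"
  unfolding skew_nondegenerate_def bilinear_on_def linear_on_def ball_double_space
proof (intro conjI ballI allI impI)
  fix x \<xi> assume *: "x \<in> V" "\<xi> \<in> D" "\<forall>y\<in>V. \<forall>\<eta>\<in>D. double_form (x, \<xi>) (y, \<eta>) = 0"
  \<comment> \<open>Testing against pure functionals determines \<open>x\<close>; testing against
    pure vectors determines \<open>\<xi>\<close>.\<close>
  have "\<eta> x = 0" if "\<eta> \<in> D" for \<eta> using *(3)[rule_format, of 0 \<eta>] *(1,2) that by simp
  then have "x = 0" using *(1) by (simp add: V_eq_iff)
  moreover have "\<xi> y = 0" if "y \<in> V" for y using *(3)[rule_format, of y 0] *(1,2) that by simp
  then have "\<xi> = 0" using *(2) by (simp add: D_eq_iff)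
  ultimately show "(x, \<xi>) = 0" by (simp add: zero_prod_def)
qed (simp_all add: algebra_simps)

lemma bilinear_double_bracket:
  "bilinear_on (double_scale s) (double_space s V) (double_scale s) (double_space s V)
     (double_scale s) (double_space s V) (double_bracket s V mg md)"
  unfolding bilinear_on_def linear_on_def ball_double_space
  by (simp add: double_bracket_apply V_eq_iff D_eq_iff) (simp add: subadj_def algebra_simps)

lemma subspace_summands:
  "double.subspace (V \<times> {0})" "double.subspace ({0} \<times> D)"
  by (auto simp: double.subspace_def zero_prod_def)

lemma dual_maps_zero [simp]:
  "x \<in> V \<Longrightarrow> L x 0 = 0" "\<xi> \<in> D \<Longrightarrow> L 0 \<xi> = 0"
  "x \<in> V \<Longrightarrow> R x 0 = 0" "\<xi> \<in> D \<Longrightarrow> R 0 \<xi> = 0"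
  "\<xi> \<in> D \<Longrightarrow> Ld \<xi> 0 = 0" "x \<in> V \<Longrightarrow> Ld 0 x = 0"
  "\<xi> \<in> D \<Longrightarrow> Rd \<xi> 0 = 0" "x \<in> V \<Longrightarrow> Rd 0 x = 0"
  by (simp_all add: D_eq_iff V_eq_iff)

section \<open>Phase spaces\<close>

lemma symplectic_phase_iff:
  "phase_space s V (subadj mg) (double_bracket s V mg md) double_form \<longleftrightarrow>
    symplectic_mock_lie (double_scale s) (double_space s V) (double_bracket s V mg md) double_form"
  unfolding phase_space_def subalgebra_def
  using mock_lie_subadj[OF g] subspace_summands
  by (auto simp: double_bracket_apply) (auto simp: subadj_def)

text \<open>The mixed terms of the bracket are dual to the two products, so in the cyclic sum the
  scalars they contribute cancel those of the brackets on the summands.\<close>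

lemma symplectic_double_iff:
  "symplectic_mock_lie (double_scale s) (double_space s V) (double_bracket s V mg md) double_form \<longleftrightarrow>
    mock_lie (double_scale s) (double_space s V) (double_bracket s V mg md)"
  unfolding symplectic_mock_lie_def ball_double_space
  using double_form_skew_nondegenerate
  by (simp add: double_bracket_apply) (simp add: subadj_def algebra_simps)

text \<open>What remains is the Jacobi identity of the double: restricted to mixed triples it gives
  \<open>compatible\<close>, and both of its components follow from the matched pair
  conditions.\<close>

lemma phase_iff:
  "phase_space s V (subadj mg) (double_bracket s V mg md) double_form \<longleftrightarrow> compatible"
  unfolding symplectic_phase_iff symplectic_double_iff
proof
  let ?B = "double_bracket s V mg md"
  assume "mock_lie (double_scale s) (double_space s V) ?B"
  then have jac: "\<forall>p\<in>double_space s V. \<forall>q\<in>double_space s V. \<forall>r\<in>double_space s V.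
      ?B p (?B q r) + ?B q (?B r p) + ?B r (?B p q) = 0"
    unfolding mock_lie_def by (elim conjE)
  define J where "J p q r = ?B p (?B q r) + ?B q (?B r p) + ?B r (?B p q)" for p q r
  have J: "J p q r = 0" if "p \<in> double_space s V" "q \<in> double_space s V" "r \<in> double_space s V" for p q r
    using jac[rule_format, OF that] unfolding J_def .
  show compatible
    unfolding compatible_def
  proof (intro conjI ballI)
    fix x y \<xi> \<eta> assume *: "x \<in> V" "y \<in> V" "\<xi> \<in> D" "\<eta> \<in> D"
    \<comment> \<open>For two vectors and one functional, the component in \<open>V\<close> of the
      Jacobi sum is the matched pair expression.\<close>
    have "- Ld \<xi> (subadj mg x y) + subadj mg (- Ld \<xi> x) y + subadj mg x (- Ld \<xi> y)
        + - Ld (- L x \<xi>) y + - Ld (- L y \<xi>) x = fst (J (x, 0) (y, 0) (0, \<xi>))"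
      using * by (simp add: J_def double_bracket_apply subadj_def add_ac)
    also have "\<dots> = 0" using J * by simp
    finally show "compat_g x y \<xi> \<eta>" using lie_pair_condition_g * by blast
  next
    fix x y \<xi> \<eta> assume *: "\<xi> \<in> D" "\<eta> \<in> D" "x \<in> V" "y \<in> V"
    \<comment> \<open>Two functionals and one vector give the other matched pair expression as
      second component.\<close>
    have "- L x (subadj md \<xi> \<eta>) + subadj md (- L x \<xi>) \<eta> + subadj md \<xi> (- L x \<eta>)
        + - L (- Ld \<xi> x) \<eta> + - L (- Ld \<eta> x) \<xi> = snd (J (0, \<xi>) (0, \<eta>) (x, 0))"
      using * by (simp add: J_def double_bracket_apply subadj_def add_ac)
    also have "\<dots> = 0" using J * by simp
    finally show "compat_dual \<xi> \<eta> x y" using lie_pair_condition_dual * by blast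
  qed
next
  let ?B = "double_bracket s V mg md"
  assume compatible: compatible
  have g': "mock_lie s V (subadj mg)" "mock_lie fun_scale D (subadj md)"
    using mock_lie_subadj[OF g] mock_lie_subadj[OF g_dual] .
  note bil = bilinear_on_subadj[OF bilinear_mg S.vector_space_axioms subspace_V]
    bilinear_on_subadj[OF bilinear_md F.vector_space_axioms subspace_D]
  have rep: "\<forall>x\<in>V. \<forall>y\<in>V. \<forall>\<xi>\<in>D. - L (subadj mg x y) \<xi> = - (- L x (- L y \<xi>)) - - L y (- L x \<xi>)"
    using mock_lie_rep_Lstar unfolding mock_lie_rep_def by (elim conjE)
  have rep_dual: "\<forall>\<xi>\<in>D. \<forall>\<eta>\<in>D. \<forall>x\<in>V.
      - Ld (subadj md \<xi> \<eta>) x = - (- Ld \<xi> (- Ld \<eta> x)) - - Ld \<eta> (- Ld \<xi> x)"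
    using mock_lie_rep_dual_Lstar unfolding mock_lie_rep_def by (elim conjE)
  have compat: "\<forall>x\<in>V. \<forall>y\<in>V. \<forall>\<xi>\<in>D. - Ld \<xi> (subadj mg x y) + subadj mg (- Ld \<xi> x) y
      + subadj mg x (- Ld \<xi> y) + - Ld (- L x \<xi>) y + - Ld (- L y \<xi>) x = 0"
    using compatible lie_pair_condition_g by (simp only: compatible_def) blast
  have compat_d: "\<forall>\<xi>\<in>D. \<forall>\<eta>\<in>D. \<forall>x\<in>V. - L x (subadj md \<xi> \<eta>) + subadj md (- L x \<xi>) \<eta>
      + subadj md \<xi> (- L x \<eta>) + - L (- Ld \<xi> x) \<eta> + - L (- Ld \<eta> x) \<xi> = 0"
    using compatible lie_pair_condition_dual by (simp only: compatible_def) blast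
  note J1 = matched_pair_jacobi_component[where \<mu> = "\<lambda>\<xi> x. - Ld \<xi> x" and \<rho> = "\<lambda>x \<xi>. - L x \<xi>"
      and bg = "subadj mg" and bh = "subadj md", OF S.vector_space_axioms subspace_V
      F.vector_space_axioms subspace_D g'(1) bil(2) bilinear_Lstar bilinear_dual_Lstar rep_dual compat]
  \<comment> \<open>The same result with the two algebras exchanged gives the component in the dual
    space.\<close>
  note J2 = matched_pair_jacobi_component[where \<mu> = "\<lambda>x \<xi>. - L x \<xi>" and \<rho> = "\<lambda>\<xi> x. - Ld \<xi> x"
      and bg = "subadj md" and bh = "subadj mg", OF F.vector_space_axioms subspace_D
      S.vector_space_axioms subspace_V g'(2) bil(1) bilinear_dual_Lstar bilinear_Lstar rep compat_d]
  have "?B p (?B q r) + ?B q (?B r p) + ?B r (?B p q) = 0"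
    if pqr: "p \<in> double_space s V" "q \<in> double_space s V" "r \<in> double_space s V" for p q r
  proof -
    obtain x \<xi> y \<eta> z \<zeta> where "p = (x, \<xi>)" "q = (y, \<eta>)" "r = (z, \<zeta>)"
      by (cases p, cases q, cases r)
    then show ?thesis
      using J1[of x y z \<xi> \<eta> \<zeta>] J2[of \<xi> \<eta> \<zeta> x y z] pqr
      by (simp add: double_bracket_apply zero_prod_def)
  qed
  moreover have "?B p q = ?B q p" for p q
    by (cases p; cases q) (simp add: double_bracket_apply subadj_def algebra_simps)
  ultimately show "mock_lie (double_scale s) (double_space s V) ?B"
    unfolding mock_lie_def by (intro conjI ballI fd_double bilinear_double_bracket)
qed

text \<open>The product of the matched pair with actions -L* - R* and R* on both sides. Its left
  multiplications are the adjoints, under \<open>double_form\<close>, of those of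
  \<open>double_bracket\<close>.\<close>

definition double_product :: "'v \<times> ('v \<Rightarrow> 'k) \<Rightarrow> 'v \<times> ('v \<Rightarrow> 'k) \<Rightarrow> 'v \<times> ('v \<Rightarrow> 'k)" where
  "double_product = (\<lambda>(x, \<xi>) (y, \<eta>).
     (mg x y - Ld \<xi> y - Rd \<xi> y + Rd \<eta> x, md \<xi> \<eta> - L x \<eta> - R x \<eta> + R y \<xi>))"

lemma double_product_apply:
  "double_product (x, \<xi>) (y, \<eta>) =
     (mg x y - Ld \<xi> y - Rd \<xi> y + Rd \<eta> x, md \<xi> \<eta> - L x \<eta> - R x \<eta> + R y \<xi>)"
  by (simp add: double_product_def)

lemma bilinear_double_product:
  "bilinear_on (double_scale s) (double_space s V) (double_scale s) (double_space s V)
     (double_scale s) (double_space s V) double_product"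
  unfolding bilinear_on_def linear_on_def ball_double_space
  by (simp add: double_product_apply V_eq_iff D_eq_iff) (simp add: algebra_simps)

section \<open>Manin triples on the double\<close>

definition extends_products where
  "extends_products m \<longleftrightarrow> (\<forall>x\<in>V. \<forall>y\<in>V. m (x, 0) (y, 0) = (mg x y, 0)) \<and>
     (\<forall>\<xi>\<in>D. \<forall>\<eta>\<in>D. m (0, \<xi>) (0, \<eta>) = (0, md \<xi> \<eta>))"

text \<open>The decomposition and the isotropy of the summands belong to the double itself, and
  their closure under \<open>m\<close> follows from \<open>extends_products\<close>.\<close>

lemma manin_triple_iff:
  assumes "extends_products m"
  shows "manin_triple (double_scale s) (double_space s V) m double_form (V \<times> {0}) ({0} \<times> D) \<longleftrightarrow>
    quadratic_mock_pre_lie (double_scale s) (double_space s V) m double_form"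
proof -
  have "double_space s V = {a + b |a b. a \<in> V \<times> {0} \<and> b \<in> {0} \<times> D}"
    by (force simp: double_space_def)
  then show ?thesis
    using assms subspace_summands
    by (auto simp: manin_triple_def subalgebra_def extends_products_def zero_prod_def)
qed

lemma quadratic_double_product:
  assumes "symplectic_mock_lie (double_scale s) (double_space s V) (double_bracket s V mg md) double_form"
  shows "quadratic_mock_pre_lie (double_scale s) (double_space s V) double_product double_form"
proof (rule quadratic_mock_pre_lie_of_symplectic[OF assms bilinear_double_product])
  fix p q r assume "p \<in> double_space s V" "q \<in> double_space s V" "r \<in> double_space s V"
  then show "double_form (double_product p q) r = double_form q (double_bracket s V mg md p r)"
    by (cases p; cases q; cases r)
      (simp add: double_product_apply double_bracket_apply, simp add: subadj_def algebra_simps)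
next
  fix p q
  show "double_product p q + double_product q p = double_bracket s V mg md p q"
    by (cases p; cases q) (simp add: double_product_apply double_bracket_apply subadj_def algebra_simps)
qed

text \<open>Invariance of the form forces the mixed products of the double up to symmetrization.\<close>

lemma subadj_eq_double_bracket:
  assumes m: "extends_products m"
    and quad: "quadratic_mock_pre_lie (double_scale s) (double_space s V) m double_form"
    and pq: "p \<in> double_space s V" "q \<in> double_space s V"
  shows "subadj m p q = double_bracket s V mg md p q"
proof -
  have bil: "bilinear_on (double_scale s) (double_space s V) (double_scale s) (double_space s V)
      (double_scale s) (double_space s V) (subadj m)"
    using mock_lie_subadj[of "double_scale s" "double_space s V" m] quad
    by (simp add: quadratic_mock_pre_lie_def mock_lie_def)
  have inv: "double_form (m p q) r = double_form q (subadj m p r)"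
    if "p \<in> double_space s V" "q \<in> double_space s V" "r \<in> double_space s V" for p q r
    using quad that unfolding quadratic_mock_pre_lie_def subadj_def by blast
  have comm: "subadj m p q = subadj m q p" for p q by (simp add: subadj_def add.commute)
  have mixed: "subadj m (x, 0) (0, \<xi>) = (- Ld \<xi> x, - L x \<xi>)" if *: "x \<in> V" "\<xi> \<in> D" for x \<xi>
  proof -
    obtain a \<zeta> where a: "subadj m (x, 0) (0, \<xi>) = (a, \<zeta>)" by (metis surj_pair)
    have "(a, \<zeta>) \<in> double_space s V"
      unfolding a[symmetric] using bil * by (simp add: bilinear_on_def linear_on_def)
    then have a_in: "a \<in> V" "\<zeta> \<in> D" by simp_all
    \<comment> \<open>Invariance applied to a known product of two vectors determines the functional
      part.\<close>
    have "\<zeta> y = \<xi> (mg x y)" if "y \<in> V" for y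
      using inv[of "(x, 0)" "(y, 0)" "(0, \<xi>)"] a a_in * that m by (simp add: extends_products_def)
    \<comment> \<open>Likewise, a known product of two functionals determines the vector
      part.\<close>
    moreover have "\<eta> a = md \<xi> \<eta> x" if "\<eta> \<in> D" for \<eta>
      using inv[of "(0, \<xi>)" "(0, \<eta>)" "(x, 0)"] a a_in * that m comm[of "(0, \<xi>)"]
      by (simp add: extends_products_def)
    ultimately show ?thesis using a a_in * by (simp add: V_eq_iff D_eq_iff)
  qed
  obtain x \<xi> y \<eta> where p: "p = (x, \<xi>)" and q: "q = (y, \<eta>)" by (metis surj_pair)
  have *: "x \<in> V" "y \<in> V" "\<xi> \<in> D" "\<eta> \<in> D" using pq p q by simp_all
  \<comment> \<open>Splitting both arguments leaves two blocks given by the products on the summands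
    and two mixed blocks. Deleting \<open>add_Pair\<close> keeps the split sums from merging
    again.\<close>
  have "subadj m p q = subadj m ((x, 0) + (0, \<xi>)) q" by (simp add: p)
  also have "\<dots> = subadj m (x, 0) q + subadj m (0, \<xi>) q"
    using bil pq(2) * by (simp add: bilinear_on_def linear_on_def del: add_Pair)
  also have "\<dots> = subadj m (x, 0) ((y, 0) + (0, \<eta>)) + subadj m (0, \<xi>) ((y, 0) + (0, \<eta>))" by (simp add: q)
  also have "\<dots> = subadj m (x, 0) (y, 0) + subadj m (x, 0) (0, \<eta>)
      + (subadj m (0, \<xi>) (y, 0) + subadj m (0, \<xi>) (0, \<eta>))"
    using bil * by (simp add: bilinear_on_def linear_on_def del: add_Pair)
  finally show ?thesis
    using mixed[of x \<eta>] mixed[of y \<xi>] comm[of "(0, \<xi>)" "(y, 0)"] m *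
    by (simp add: extends_products_def p q double_bracket_apply)
      (simp add: subadj_def extends_products_def diff_right_commute)
qed

text \<open>A Manin triple induces the double bracket on the carrier, hence a symplectic form for
  it; conversely \<open>double_product\<close> is the witness.\<close>

lemma manin_iff:
  "(\<exists>m. manin_triple (double_scale s) (double_space s V) m double_form (V \<times> {0}) ({0} \<times> D) \<and>
      extends_products m) \<longleftrightarrow> compatible"
  (is "?lhs \<longleftrightarrow> _")
proof -
  have "?lhs \<longleftrightarrow>
    symplectic_mock_lie (double_scale s) (double_space s V) (double_bracket s V mg md) double_form"
  proof
    assume ?lhs
    then obtain m where m: "extends_products m"
      "quadratic_mock_pre_lie (double_scale s) (double_space s V) m double_form"
      using manin_triple_iff by blast
    from symplectic_mock_lie_cong[OF symplectic_mock_lie_subadj[OF m(2)] subadj_eq_double_bracket[OF m]]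
    show "symplectic_mock_lie (double_scale s) (double_space s V) (double_bracket s V mg md) double_form" .
  next
    assume "symplectic_mock_lie (double_scale s) (double_space s V) (double_bracket s V mg md) double_form"
    moreover have "extends_products double_product"
      by (simp add: extends_products_def double_product_apply)
    ultimately show ?lhs using manin_triple_iff quadratic_double_product by blast
  qed
  then show ?thesis by (simp only: phase_iff[symmetric] symplectic_phase_iff)
qed

end

section \<open>Equivalence of the five conditions\<close>

theorem theorem3p7:
  fixes s :: "'k::{alg_closed_field, field_char_0} \<Rightarrow> 'v::ab_group_add \<Rightarrow> 'v"
    and V :: "'v set"
    and mg :: "'v \<Rightarrow> 'v \<Rightarrow> 'v"
    and md :: "('v \<Rightarrow> 'k) \<Rightarrow> ('v \<Rightarrow> 'k) \<Rightarrow> ('v \<Rightarrow> 'k)"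
    and \<alpha> :: "'v \<Rightarrow> ('v \<Rightarrow> 'k) \<Rightarrow> ('v \<Rightarrow> 'k) \<Rightarrow> 'k"
    and \<beta> :: "('v \<Rightarrow> 'k) \<Rightarrow> (('v \<Rightarrow> 'k) \<Rightarrow> 'k) \<Rightarrow> (('v \<Rightarrow> 'k) \<Rightarrow> 'k) \<Rightarrow> 'k"
  assumes g: "mock_pre_lie s V mg"
    and g_dual: "mock_pre_lie fun_scale (dual_space s V) md"
    and \<alpha>: "dual_of_dual_product s V md \<alpha>"
    and \<beta>: "dual_of_product s V mg \<beta>"
  defines "bialgebra \<equiv> mock_pre_lie_bialgebra s V mg md \<alpha> \<beta>"
    and "pre_lie_pair \<equiv> mock_pre_lie_matched_pair s V mg fun_scale (dual_space s V) md
           (\<lambda>x \<xi>. - Lstar V mg x \<xi> - Rstar V mg x \<xi>) (Rstar V mg)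
           (\<lambda>\<xi> x. - dual_Lstar s V md \<xi> x - dual_Rstar s V md \<xi> x) (dual_Rstar s V md)"
    and "manin \<equiv> \<exists>m. manin_triple (double_scale s) (double_space s V) m double_form
             (V \<times> {0}) ({0} \<times> dual_space s V) \<and>
           (\<forall>x\<in>V. \<forall>y\<in>V. m (x, 0) (y, 0) = (mg x y, 0)) \<and>
           (\<forall>\<xi>\<in>dual_space s V. \<forall>\<eta>\<in>dual_space s V. m (0, \<xi>) (0, \<eta>) = (0, md \<xi> \<eta>))"
    and "lie_pair \<equiv> mock_lie_matched_pair s V (subadj mg) fun_scale (dual_space s V) (subadj md)
           (\<lambda>x \<xi>. - Lstar V mg x \<xi>) (\<lambda>\<xi> x. - dual_Lstar s V md \<xi> x)"
    and "phase \<equiv> phase_space s V (subadj mg) (double_bracket s V mg md) double_form"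
  shows "(bialgebra \<longleftrightarrow> pre_lie_pair) \<and> (bialgebra \<longleftrightarrow> manin) \<and>
         (bialgebra \<longleftrightarrow> lie_pair) \<and> (bialgebra \<longleftrightarrow> phase)"
proof -
  \<comment> \<open>In this locale each of the five conditions is equivalent to
    \<open>compatible\<close>.\<close>
  interpret dual_mock_pre_lie s V mg md
    using g g_dual by unfold_locales
  show ?thesis
    unfolding bialgebra_def pre_lie_pair_def manin_def lie_pair_def phase_def
    using bialgebra_iff[OF \<alpha> \<beta>] pre_lie_pair_iff manin_iff[unfolded extends_products_def]
      lie_pair_iff phase_iff
    by simp
qed

end
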